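(* Consider the opportunistic beamforming network described in the context with path loss model $G(d)=(1+d^{\alpha})^{-1}$, $\alpha>2$, and let $\epsilon\in(0,1)$. Let $y^\star$ be the solution in $y\in(1,\infty)$ of $$\log\left(y^a(y-1)\right)+\frac{\alpha}{2\rho}(y-1)-\frac{\alpha}{2}\log\left(\frac{-b}{\log\epsilon}\right)=0,$$ where $a=\frac{\alpha}{2}(M-1)$ and $b=\frac{2\lambda\pi}{\alpha}\Gamma\left(\frac{2}{\alpha}\right)\rho^{\frac{2}{\alpha}}$. Then the beam outage capacity $C_{\mathrm{out,b}}(\epsilon)$ in the large system limit ($D\to\infty$) is equal to $\log(y^\star)$. Moreover, $C_{\mathrm{out,b}}(\epsilon)$ scales according to $O(\log\log\lambda)$ as the user intensity $\lambda$ grows large (with $M,\alpha,\rho,\epsilon$ fixed).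
   Context: Network model. The cell is the disk of radius $D>0$ in the plane with the base station (BS) at its center. Mobile users (MUs) are distributed over the plane according to a homogeneous Poisson point process of intensity $\lambda>0$. Let $N$ be the (random) number of MUs in the cell, so $N$ is Poisson with mean $\lambda\pi D^2$; given $N$, the MU locations in the cell are i.i.d. uniform on the disk. The BS has $M\ge 1$ antennas, each MU has a single antenna, and the BS uses $M$ orthonormal beamforming vectors $\boldsymbol b_1,\dots,\boldsymbol b_M\in\mathbb C^M$ (generated independently of everything else), with transmit power $\rho>0$ per beam. The fading vector $\boldsymbol h_i\in\mathbb C^M$ of MU $i$ has i.i.d. entries drawn from the zero-mean unit-variance circularly-symmetric complex Gaussian distribution $\mathcal{CN}(0,1)$; fading vectors are independent across MUs and independent of the MU locations. The path loss coefficient of MU $i$ is $g_i=G(d_i)$, where $d_i$ is its distance from the BS. SINR. The signal-to-interference-plus-noise ratio of beam $m$ at MU $i$ is $$\gamma_{m,i}=\frac{|\boldsymbol h_i^\top\boldsymbol b_m|^2}{(\rho g_i)^{-1}+\sum_{k\ne m}|\boldsymbol h_i^\top\boldsymbol b_k|^2}.$$ Rate and outage. The BS schedules on each beam the MU in the cell with the highest SINR on that beam; the rate on beam $m$ is $r_m=\log\left(1+\max_i\gamma_{m,i}\right)$, the maximum being over the $N$ MUs in the cell and taken to be $0$ if $N=0$. The beam outage probability at target rate $x$ is $F_r(x)=\Pr\{r_m\le x\}$ (it does not depend on $m$). Outage capacity. For $\epsilon\in(0,1)$ the beam outage capacity is $C_{\mathrm{out}}(\epsilon)=\sup\{x: F_r(x)\le\epsilon\}$.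 In the large system limit, $F_r$ is replaced in this definition by its pointwise limit $\lim_{D\to\infty}F_r(x)$, all other parameters being fixed; for the path loss model $G(d)=(1+d^\alpha)^{-1}$ the resulting capacity is denoted $C_{\mathrm{out,b}}(\epsilon)$. $\Gamma$ is the gamma function, and $\log$ is the natural logarithm. *)

theory Defs
  imports "HOL-Probability.Probability"
begin

text \<open>
  A point process is given by a measurable enumeration \<open>X 0, X 1, \<dots>\<close> of its (almost surely
  infinitely many) points; the number of points in a region \<open>A\<close> is \<open>card {i. X i w \<in> A}\<close>.
  The Poisson probabilities are written out so that regions of area zero are covered
  (\<open>poisson_pmf\<close> is intended for positive rates only).
\<close>

definition poisson_point_process ::
    "'w measure \<Rightarrow> real \<Rightarrow> (nat \<Rightarrow> 'w \<Rightarrow> 'p::euclidean_space) \<Rightarrow> bool" where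
  "poisson_point_process P lam X \<longleftrightarrow>
     prob_space P \<and>
     (\<forall>i. X i \<in> borel_measurable P) \<and>
     (\<forall>w\<in>space P. \<forall>A. bounded A \<longrightarrow> finite {i. X i w \<in> A}) \<and>
     (\<forall>A\<in>sets borel. bounded A \<longrightarrow>
        (\<forall>n. measure P {w \<in> space P. card {i. X i w \<in> A} = n} =
               (lam * measure lborel A) ^ n / fact n * exp (- (lam * measure lborel A)))) \<and>
     (\<forall>(A :: nat \<Rightarrow> 'p set) k.
        (\<forall>j<k. A j \<in> sets borel \<and> bounded (A j)) \<and> disjoint_family_on A {..<k} \<longrightarrow>
        prob_space.indep_vars P (\<lambda>_. count_space UNIV) (\<lambda>j w. card {i. X i w \<in> A j}) {..<k})"

text \<open>Density of the zero-mean unit-variance circularly-symmetric complex Gaussian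
  distribution with respect to Lebesgue measure on the complex plane.\<close>

definition cn01_density :: "complex \<Rightarrow> real" where
  "cn01_density z = exp (- (cmod z)\<^sup>2) / pi"

text \<open>The bilinear product \<open>u\<^sup>T v\<close> (no conjugation).\<close>

definition tdot :: "complex ^ 'm \<Rightarrow> complex ^ 'm \<Rightarrow> complex" where
  "tdot u v = (\<Sum>j\<in>UNIV. u $ j * v $ j)"

definition orthonormal_beams :: "('m \<Rightarrow> complex ^ 'm) \<Rightarrow> bool" where
  "orthonormal_beams b \<longleftrightarrow>
     (\<forall>m k. (\<Sum>j\<in>UNIV. b m $ j * cnj (b k $ j)) = (if m = k then 1 else 0))"

text \<open>
  The number of antennas, and of beams, is \<open>CARD('m)\<close>. The map \<open>X i\<close> is the location of user \<open>i\<close>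
  in the plane, with the base station at the origin, \<open>h i\<close> is its fading vector, and \<open>b m\<close> is the
  \<open>m\<close>-th beamforming vector. The last two assumptions make the family of locations, the family of
  fading vectors and the family of beams mutually independent; they are phrased with the
  \<open>\<sigma>\<close>-algebras generated by these families because \<open>indep_var\<close> only relates variables with values
  in one and the same type.
\<close>

locale beamforming_network = prob_space P
  for P :: "'w measure" +
  fixes lam :: real
    and X :: "nat \<Rightarrow> 'w \<Rightarrow> real ^ 2"
    and h :: "nat \<Rightarrow> 'w \<Rightarrow> complex ^ 'm"
    and b :: "'m \<Rightarrow> 'w \<Rightarrow> complex ^ 'm"
  assumes locations: "poisson_point_process P lam X"
    and fading_indep: "indep_vars (\<lambda>_. borel) h UNIV"
    and fading_entries_indep: "\<And>i. indep_vars (\<lambda>_. borel) (\<lambda>j w. h i w $ j) UNIV"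
    and fading_entries_distr:
      "\<And>i j. distributed P lborel (\<lambda>w. h i w $ j) (\<lambda>z. ennreal (cn01_density z))"
    and beams_measurable: "\<And>m. b m \<in> borel_measurable P"
    and beams_orthonormal: "AE w in P. orthonormal_beams (\<lambda>m. b m w)"
    and locations_fading_indep:
      "indep_set
         (sets (vimage_algebra (space P) (\<lambda>w i. X i w) (\<Pi>\<^sub>M i\<in>UNIV. borel)))
         (sets (vimage_algebra (space P) (\<lambda>w i. h i w) (\<Pi>\<^sub>M i\<in>UNIV. borel)))"
    and beams_indep:
      "indep_set
         (sets (vimage_algebra (space P) (\<lambda>w m. b m w) (\<Pi>\<^sub>M m\<in>UNIV. borel)))
         (sets (vimage_algebra (space P) (\<lambda>w. (\<lambda>i. X i w, \<lambda>i. h i w))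
            ((\<Pi>\<^sub>M i\<in>UNIV. borel) \<Otimes>\<^sub>M (\<Pi>\<^sub>M i\<in>UNIV. borel))))"

definition sinr :: "real \<Rightarrow> real \<Rightarrow> complex ^ 'm \<Rightarrow> ('m \<Rightarrow> complex ^ 'm) \<Rightarrow> 'm \<Rightarrow> real" where
  "sinr \<rho> g u b m =
     (cmod (tdot u (b m)))\<^sup>2 /
     (inverse (\<rho> * g) + (\<Sum>k\<in>UNIV - {m}. (cmod (tdot u (b k)))\<^sup>2))"

definition cell_users :: "(nat \<Rightarrow> 'w \<Rightarrow> real ^ 2) \<Rightarrow> real \<Rightarrow> 'w \<Rightarrow> nat set" where
  "cell_users X D w = {i. X i w \<in> cball 0 D}"

definition beam_rate ::
    "(real \<Rightarrow> real) \<Rightarrow> real \<Rightarrow> (nat \<Rightarrow> 'w \<Rightarrow> real ^ 2) \<Rightarrow> (nat \<Rightarrow> 'w \<Rightarrow> complex ^ 'm) \<Rightarrow>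
     ('m \<Rightarrow> 'w \<Rightarrow> complex ^ 'm) \<Rightarrow> real \<Rightarrow> 'm \<Rightarrow> 'w \<Rightarrow> real" where
  "beam_rate G \<rho> X h b D m w =
     ln (1 + (if cell_users X D w = {} then 0
              else MAX i\<in>cell_users X D w.
                     sinr \<rho> (G (dist (X i w) 0)) (h i w) (\<lambda>k. b k w) m))"

definition beam_outage_prob ::
    "'w measure \<Rightarrow> (real \<Rightarrow> real) \<Rightarrow> real \<Rightarrow> (nat \<Rightarrow> 'w \<Rightarrow> real ^ 2) \<Rightarrow> (nat \<Rightarrow> 'w \<Rightarrow> complex ^ 'm) \<Rightarrow>
     ('m \<Rightarrow> 'w \<Rightarrow> complex ^ 'm) \<Rightarrow> real \<Rightarrow> 'm \<Rightarrow> real \<Rightarrow> real" where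
  "beam_outage_prob P G \<rho> X h b D m x = measure P {w \<in> space P. beam_rate G \<rho> X h b D m w \<le> x}"

definition outage_capacity :: "(real \<Rightarrow> real) \<Rightarrow> real \<Rightarrow> real" where
  "outage_capacity F \<epsilon> = Sup {x. F x \<le> \<epsilon>}"

definition path_loss_b :: "real \<Rightarrow> real \<Rightarrow> real" where
  "path_loss_b \<alpha> d = inverse (1 + d powr \<alpha>)"

definition outage_capacity_b ::
    "'w measure \<Rightarrow> real \<Rightarrow> real \<Rightarrow> (nat \<Rightarrow> 'w \<Rightarrow> real ^ 2) \<Rightarrow> (nat \<Rightarrow> 'w \<Rightarrow> complex ^ 'm) \<Rightarrow>
     ('m \<Rightarrow> 'w \<Rightarrow> complex ^ 'm) \<Rightarrow> 'm \<Rightarrow> real \<Rightarrow> real" where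
  "outage_capacity_b P \<alpha> \<rho> X h b m \<epsilon> =
     outage_capacity
       (\<lambda>x. Lim at_top (\<lambda>D. beam_outage_prob P (path_loss_b \<alpha>) \<rho> X h b D m x)) \<epsilon>"

end

theory Submission
  imports Defs
begin

text \<open>
  Orthonormal beams act on the fading vectors as a unitary map, which preserves their Gaussian law.
  The SINR of a user at distance \<open>r\<close> therefore exceeds \<open>z\<close> with probability
  \<open>p r = exp (- z * (1 + r powr \<alpha>) / \<rho>) / (1 + z) ^ (M - 1)\<close>: the signal power is exponentially
  distributed and independent of the interference, a sum of \<open>M - 1\<close> exponentials. Given the locations,
  the outage probability is the product of \<open>1 - p r\<close> over the users in the cell. Cutting the cell into
  annuli of equal area, on which \<open>p\<close> is almost constant and the user counts are independent Poisson
  variables, shows that the mean of this product is \<open>exp (- lam * \<integral>p)\<close>. For \<open>D \<rightarrow> \<infinity>\<close> the integral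
  becomes a Gamma integral, and taking logarithms at \<open>z = y - 1\<close> turns the outage constraint into the
  equation for \<open>y\<close>. Its left-hand side is strictly increasing, and it forces \<open>y\<close> to be at most linear
  in \<open>ln lam\<close>.
\<close>

section \<open>Lebesgue measure under orthogonal transformations\<close>

text \<open>The point process is given only through its counts in bounded regions; that users are
  uniform given their number is not among the axioms. The mean of a product over users therefore has
  to be squeezed between products that depend on counts alone, and the monotonicity of
  \<open>p\<close> in the distance makes both bounds explicit. In the squared distance equal areas
  become equal steps, so the two bounds are Darboux sums of one integral.

  The beams are random and orthonormal only almost surely. Conditioning on them means writing the
  law of the whole network as a product law. Their unitary map is treated as a real orthogonal map
  of a Euclidean space: the Gaussian density depends on the norm alone, so its invariance reduces to
  that of Lebesgue measure.

  Rate 0 needs separate care: there \<open>p\<close> is 1 at every distance, so the integral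
  diverges with \<open>D\<close> and the limit of the outage probability is 0.\<close>

text \<open>By Vitali's covering theorem an open set is, up to a null set, a disjoint union of balls, and an
  orthogonal transformation maps balls to balls of the same radius.\<close>

lemma emeasure_lborel_orthogonal_image_ge:
  fixes f :: "'a::euclidean_space \<Rightarrow> 'a"
  assumes f: "orthogonal_transformation f" and S: "open S"
  shows "emeasure lborel S \<le> emeasure lborel (f ` S)"
proof -
  define K where "K = {p. 0 < snd p \<and> ball (fst p) (snd p) \<subseteq> S}"
  have "\<exists>i. i \<in> K \<and> x \<in> ball (fst i) (snd i) \<and> snd i < d" if "x \<in> S" "0 < d" for x d
  proof -
    obtain r where r: "r > 0" "ball x r \<subseteq> S" using S \<open>x \<in> S\<close> openE by blast
    \<comment> \<open>The first bound keeps the ball inside \<open>S\<close>, the second makes it as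
      small as the Vitali cover demands.\<close>
    have "(x, min r (d/2)) \<in> K" using r that by (auto simp: K_def)
    then show ?thesis using that r by (intro exI[of _ "(x, min r (d/2))"]) auto
  qed
  then obtain C where C: "countable C" "C \<subseteq> K"
     "pairwise (\<lambda>i j. disjnt (ball (fst i) (snd i)) (ball (fst j) (snd j))) C"
     "negligible (S - (\<Union>i \<in> C. ball (fst i) (snd i)))"
    by (rule Vitali_covering_theorem_balls)
  define B where "B = (\<lambda>p. ball (fst p) (snd p) :: 'a set)"
  let ?U = "\<Union>i\<in>C. B i"
  have inj: "inj f" using f orthogonal_transformation_inj by blast
  have disj: "disjoint_family_on B C"
    using C(3) by (auto simp: disjoint_family_on_def pairwise_def B_def disjnt_def)
  have fB: "f ` B i = ball (f (fst i)) (snd i)" for i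
    unfolding B_def by (rule image_orthogonal_transformation_ball[OF f])
  have disj': "disjoint_family_on (\<lambda>i. f ` B i) C"
    using disj inj by (simp add: disjoint_family_on_def image_Int[symmetric])
  have [measurable]: "B i \<in> sets lborel" "f ` B i \<in> sets lborel" for i
    unfolding fB by (auto simp: B_def)
  have US: "?U \<subseteq> S" using C(2) by (auto simp: K_def B_def)
  \<comment> \<open>Here \<open>i\<close> ranges over all pairs, so the radius may be negative; both
    balls are empty then.\<close>
  have "emeasure lborel (f ` B i) = emeasure lborel (B i)" for i
  proof (cases "snd i \<ge> 0")
    case True then show ?thesis unfolding fB by (simp add: B_def emeasure_ball)
  next
    case False then show ?thesis unfolding fB by (simp add: B_def ball_empty)
  qed
  then have eq: "emeasure lborel ?U = emeasure lborel (\<Union>i\<in>C. f ` B i)"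
    using disj disj' C(1) by (simp only: emeasure_UN_countable \<open>\<And>i. B i \<in> sets lborel\<close> \<open>\<And>i. f ` B i \<in> sets lborel\<close>)
  have Um: "?U \<in> sets lborel" using C(1) \<open>\<And>i. B i \<in> sets lborel\<close> by (intro sets.countable_UN') blast+
  have Sm: "S \<in> sets lborel" using S by simp
  have "S - ?U \<in> null_sets lborel"
    using C(4) Um Sm by (simp add: negligible_iff_null_sets null_sets_completion_iff B_def)
  then have "emeasure lborel (?U \<union> (S - ?U)) = emeasure lborel ?U"
    using Um by (intro emeasure_Un_null_set) auto
  then have "emeasure lborel S = emeasure lborel ?U" using US by (simp add: Un_absorb1)
  \<comment> \<open>The image of the null remainder is simply dropped, since nothing is known yet
    about images of null sets. This is why only an inequality comes out; the inverse map will supply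
    the other one.\<close>
  also have "\<dots> \<le> emeasure lborel (f ` S)"
    unfolding eq
  proof (rule emeasure_mono)
    show "(\<Union>i\<in>C. f ` B i) \<subseteq> f ` S" using US by blast
    have "f ` S = inv f -` S"
      using bij_vimage_eq_inv_image[of "inv f" S] orthogonal_transformation_bij[OF f]
      by (simp add: bij_imp_bij_inv inv_inv_eq)
    moreover have "linear (inv f)"
      using orthogonal_transformation_inv[OF f] orthogonal_transformation_linear by blast
    ultimately show "f ` S \<in> sets lborel"
      using S linear_continuous_on[of "inv f" UNIV] 
      by (auto intro!: borel_open open_vimage simp: linear_conv_bounded_linear)
  qed
  finally show ?thesis .
qed

lemma borel_measurable_orthogonal_transformation:
  fixes f :: "'a::euclidean_space \<Rightarrow> 'a"
  assumes "orthogonal_transformation f"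
  shows "f \<in> borel_measurable borel"
  using orthogonal_transformation_linear[OF assms] linear_continuous_on
  by (auto simp: linear_conv_bounded_linear intro!: borel_measurable_continuous_onI)

lemma lborel_distr_orthogonal_transformation:
  fixes f :: "'a::euclidean_space \<Rightarrow> 'a"
  assumes f: "orthogonal_transformation f"
  shows "distr lborel borel f = lborel"
proof (rule lborel_eqI[symmetric])
  fix l u :: 'a assume lu: "\<And>b. b \<in> Basis \<Longrightarrow> l \<bullet> b \<le> u \<bullet> b"
  have bij: "bij f" using f orthogonal_transformation_bij by blast
  have g: "orthogonal_transformation (inv f)" using orthogonal_transformation_inv[OF f] .
  have cont: "continuous_on UNIV f"
    using orthogonal_transformation_linear[OF f] linear_continuous_on
    by (auto simp: linear_conv_bounded_linear)
  then have fm[measurable]: "f \<in> borel_measurable borel" by (rule borel_measurable_continuous_onI)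
  have pre: "f -` box l u = inv f ` box l u"
    using bij by (simp add: bij_vimage_eq_inv_image)
  have op: "open (f -` box l u)" using cont by (intro open_vimage open_box)
  \<comment> \<open>The preimage of a box is open but in general not a box, so the inequality is
    used for an arbitrary open set here and for a box with the inverse map below.\<close>
  have "emeasure lborel (f -` box l u) \<le> emeasure lborel (f ` (f -` box l u))"
    by (rule emeasure_lborel_orthogonal_image_ge[OF f op])
  also have "f ` (f -` box l u) = box l u" using bij by (simp add: bij_is_surj)
  finally have "emeasure lborel (f -` box l u) \<le> emeasure lborel (box l u)" .
  moreover have "emeasure lborel (box l u) \<le> emeasure lborel (f -` box l u)"
    unfolding pre by (rule emeasure_lborel_orthogonal_image_ge[OF g open_box])
  ultimately have "emeasure lborel (f -` box l u) = emeasure lborel (box l u)" by simp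
  then show "emeasure (distr lborel borel f) (box l u) = (\<Prod>b\<in>Basis. (u - l) \<bullet> b)"
    using lu by (simp add: emeasure_distr)
qed simp

section \<open>Lebesgue measure on vectors as a product over coordinates\<close>

lemma measurable_vec_lambda:
  "(\<lambda>x. vec_lambda x :: 'a::euclidean_space ^ 'm) \<in> borel_measurable (\<Pi>\<^sub>M i\<in>UNIV. borel)"
proof (subst borel_measurable_euclidean_space, safe)
  fix i :: "'a ^ 'm" assume "i \<in> Basis"
  then obtain j b where "i = axis j b" "b \<in> Basis" by (auto simp: Basis_vec_def)
  then show "(\<lambda>x. vec_lambda x \<bullet> i) \<in> borel_measurable (\<Pi>\<^sub>M i\<in>UNIV. borel)"
    by (simp add: inner_axis)
qed

lemma prod_Basis_vec:
  "(\<Prod>b\<in>(Basis :: ('a::euclidean_space ^ 'm) set). f b) = (\<Prod>i\<in>UNIV. \<Prod>b\<in>Basis. f (axis i b))"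
proof -
  have "(\<Prod>i\<in>(UNIV::'m set). \<Prod>b\<in>(Basis::'a set). f (axis i b)) = (\<Prod>(i,b)\<in>UNIV\<times>Basis. f (axis i b))"
    by (simp add: prod.cartesian_product)
  also have "\<dots> = (\<Prod>p\<in>(UNIV::'m set)\<times>(Basis::'a set). f (case p of (i,b) \<Rightarrow> axis i b))"
    by (simp add: case_prod_unfold)
  also have "\<dots> = (\<Prod>b\<in>(Basis :: ('a ^ 'm) set). f b)"
  proof (rule prod.reindex_bij_betw)
    show "bij_betw (\<lambda>(i, b). axis i b) (UNIV \<times> Basis) (Basis :: ('a ^ 'm) set)"
      unfolding bij_betw_def
    proof
      show "inj_on (\<lambda>(i, b). axis i b :: 'a ^ 'm) (UNIV \<times> Basis)"
        by (auto simp: inj_on_def axis_eq_axis nonzero_Basis)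
      show "(\<lambda>(i, b). axis i b) ` (UNIV \<times> Basis) = (Basis :: ('a ^ 'm) set)"
        by (force simp: Basis_vec_def)
    qed
  qed
  finally show ?thesis by simp
qed

text \<open>Bridges two views of the vector space: as a Euclidean space, where orthogonal maps act,
  and as a product over coordinates, where independence of the entries is expressed. Boxes
  correspond to products of coordinate boxes.\<close>

lemma lborel_vec_eq_distr_PiM:
  "(lborel :: ('a::euclidean_space ^ 'm) measure) =
     distr (\<Pi>\<^sub>M i\<in>UNIV. lborel) borel vec_lambda"
proof (rule lborel_eqI)
  fix l u :: "'a ^ 'm" assume lu: "\<And>b. b \<in> Basis \<Longrightarrow> l \<bullet> b \<le> u \<bullet> b"
  interpret product_sigma_finite "\<lambda>_::'m. lborel :: 'a measure"
    by (simp add: lborel.sigma_finite_measure_axioms product_sigma_finite_def)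
  have [measurable]: "(vec_lambda :: _ \<Rightarrow> 'a ^ 'm) \<in> borel_measurable (\<Pi>\<^sub>M i\<in>UNIV. lborel)"
    using measurable_vec_lambda by (simp cong: measurable_cong_sets sets_PiM_cong)
  have lu': "(l $ i) \<bullet> b \<le> (u $ i) \<bullet> b" if "b \<in> Basis" for i b
    using lu[of "axis i b"] that by (simp add: inner_axis)
  have "vec_lambda -` box l u \<inter> space (\<Pi>\<^sub>M i\<in>UNIV. lborel) = Pi\<^sub>E UNIV (\<lambda>i. box (l $ i) (u $ i))"
    by (auto simp: space_PiM box_def Basis_vec_def inner_axis PiE_def)
  then have "emeasure (distr (\<Pi>\<^sub>M i\<in>UNIV. lborel) borel vec_lambda) (box l u)
      = emeasure (\<Pi>\<^sub>M i\<in>UNIV. lborel) (Pi\<^sub>E UNIV (\<lambda>i. box (l $ i) (u $ i)))"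
    by (simp add: emeasure_distr)
  also have "\<dots> = (\<Prod>i\<in>UNIV. emeasure lborel (box (l $ i) (u $ i)))"
    by (rule emeasure_PiM) auto
  also have "\<dots> = (\<Prod>i\<in>UNIV. ennreal (\<Prod>b\<in>Basis. (u $ i - l $ i) \<bullet> b))"
    using lu' by simp
  also have "\<dots> = ennreal (\<Prod>i\<in>UNIV. \<Prod>b\<in>Basis. (u $ i - l $ i) \<bullet> b)"
    using lu' by (intro prod_ennreal prod_nonneg) (auto simp: inner_diff_left)
  also have "(\<Prod>i\<in>UNIV. \<Prod>b\<in>Basis. (u $ i - l $ i) \<bullet> b) = (\<Prod>b\<in>Basis. (u - l) \<bullet> b)"
    by (simp add: prod_Basis_vec inner_axis)
  finally show "emeasure (distr (\<Pi>\<^sub>M i\<in>UNIV. lborel) borel vec_lambda) (box l u)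
      = (\<Prod>b\<in>Basis. (u - l) \<bullet> b)" by simp
qed simp

section \<open>Complex Gaussian vectors\<close>

text \<open>A product measure is determined by its values on rectangles, and there the integrand
  factors over the coordinates. The assumption \<open>ps\<close> supplies sigma-finiteness of the
  factors.\<close>

lemma PiM_density_lborel:
  fixes f :: "'a::euclidean_space \<Rightarrow> ennreal"
  assumes f[measurable]: "f \<in> borel_measurable borel"
    and ps: "prob_space (density lborel f)"
  shows "(\<Pi>\<^sub>M i\<in>(UNIV::'m::finite set). density lborel f) =
           density (\<Pi>\<^sub>M i\<in>UNIV. lborel) (\<lambda>x. \<Prod>i\<in>UNIV. f (x i))"
proof -
  interpret L: product_sigma_finite "\<lambda>_::'m. lborel :: 'a measure"
    by (simp add: lborel.sigma_finite_measure_axioms product_sigma_finite_def)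
  interpret D: product_sigma_finite "\<lambda>_::'m. density lborel f"
    using ps by (simp add: prob_space_imp_sigma_finite product_sigma_finite_def)
  show ?thesis
  proof (rule D.PiM_eqI[symmetric])
    show "sets (density (\<Pi>\<^sub>M i\<in>(UNIV::'m set). lborel) (\<lambda>x. \<Prod>i\<in>UNIV. f (x i))) =
        sets (\<Pi>\<^sub>M i\<in>UNIV. density lborel f)"
      by (simp cong: sets_PiM_cong)
  next
    fix A :: "'m \<Rightarrow> 'a set"
    assume "\<And>i. i \<in> UNIV \<Longrightarrow> A i \<in> sets (density lborel f)"
    then have [measurable]: "A i \<in> sets borel" for i by simp
    have AP: "Pi\<^sub>E UNIV A \<in> sets (\<Pi>\<^sub>M i\<in>(UNIV::'m set). (lborel :: 'a measure))"
      by (intro sets_PiM_I_finite) auto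
    have "emeasure (density (\<Pi>\<^sub>M i\<in>(UNIV::'m set). lborel) (\<lambda>x. \<Prod>i\<in>UNIV. f (x i))) (Pi\<^sub>E UNIV A) =
       (\<integral>\<^sup>+x. (\<Prod>i\<in>UNIV. f (x i)) * indicator (Pi\<^sub>E UNIV A) x \<partial>(\<Pi>\<^sub>M i\<in>UNIV. lborel))"
      using AP by (subst emeasure_density) auto
    also have "\<dots> = (\<integral>\<^sup>+x. (\<Prod>i\<in>UNIV. f (x i) * indicator (A i) (x i)) \<partial>(\<Pi>\<^sub>M i\<in>UNIV. lborel))"
    proof (intro nn_integral_cong)
      fix x :: "'m \<Rightarrow> 'a"
      have "indicator (Pi\<^sub>E UNIV A) x = (\<Prod>i\<in>UNIV. indicator (A i) (x i) :: ennreal)"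
        by (auto simp: indicator_def PiE_def prod_zero_iff intro!: prod.neutral)
      then show "(\<Prod>i\<in>UNIV. f (x i)) * indicator (Pi\<^sub>E UNIV A) x = (\<Prod>i\<in>UNIV. f (x i) * indicator (A i) (x i))"
        by (simp add: prod.distrib)
    qed
    also have "\<dots> = (\<Prod>i\<in>UNIV. \<integral>\<^sup>+x. f x * indicator (A i) x \<partial>lborel)"
      by (rule L.product_nn_integral_prod) auto
    also have "\<dots> = (\<Prod>i\<in>UNIV. emeasure (density lborel f) (A i))"
      by (simp add: emeasure_density)
    finally show "emeasure (density (\<Pi>\<^sub>M i\<in>(UNIV::'m set). lborel) (\<lambda>x. \<Prod>i\<in>UNIV. f (x i))) (Pi\<^sub>E UNIV A) =
       (\<Prod>i\<in>UNIV. emeasure (density lborel f) (A i))" .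
  qed simp
qed

text \<open>The standard complex Gaussian law, written as a single density in the norm so that its
  invariance under norm-preserving maps can be read off.\<close>

definition cn_vec :: "(complex ^ 'm) measure" where
  "cn_vec = density lborel (\<lambda>u. ennreal (exp (- (norm u)\<^sup>2) / pi ^ CARD('m)))"

lemma cn01_density_measurable[measurable]: "cn01_density \<in> borel_measurable borel"
  unfolding cn01_density_def by measurable

lemma sets_cn_vec[simp, measurable_cong]: "sets cn_vec = sets borel"
  by (simp add: cn_vec_def)

lemma space_cn_vec[simp]: "space cn_vec = UNIV"
  by (simp add: cn_vec_def)

lemma prod_cn01_density:
  "(\<Prod>i\<in>UNIV. cn01_density (u $ i)) = exp (- (norm u)\<^sup>2) / pi ^ CARD('m)"
  for u :: "complex ^ 'm"
  by (simp add: cn01_density_def prod_dividef norm_vec_def L2_set_def sum_nonneg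
      exp_sum[symmetric] sum_negf)

lemma (in prob_space) distr_cn_vec:
  fixes U :: "'a \<Rightarrow> complex ^ 'm"
  assumes ind: "indep_vars (\<lambda>_. borel) (\<lambda>j w. U w $ j) UNIV"
    and D: "\<And>j. distributed M lborel (\<lambda>w. U w $ j) (\<lambda>z. ennreal (cn01_density z))"
  shows "distr M borel U = cn_vec"
proof -
  have rv[measurable]: "(\<lambda>w. U w $ j) \<in> borel_measurable M" for j
    using D[of j] by (simp add: distributed_def)
  have dj: "distr M borel (\<lambda>w. U w $ j) = density lborel (\<lambda>z. ennreal (cn01_density z))" for j
    using D[of j] by (simp add: distributed_def cong: distr_cong)
  have ps: "prob_space (density lborel (\<lambda>z. ennreal (cn01_density z)))"
    unfolding dj[symmetric, of undefined] by (rule prob_space_distr) simp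
  note mv = measurable_vec_lambda[where 'a=complex and 'm='m]
  have mvl: "vec_lambda \<in> (\<Pi>\<^sub>M i\<in>(UNIV::'m set). lborel) \<rightarrow>\<^sub>M (borel :: (complex ^ 'm) measure)"
    using mv by (simp cong: measurable_cong_sets sets_PiM_cong)
  have mU: "(\<lambda>w j. U w $ j) \<in> M \<rightarrow>\<^sub>M (\<Pi>\<^sub>M i\<in>UNIV. borel)"
    by (rule measurable_PiM_single') (auto simp: rv)
  have "distr M borel U = distr M borel (\<lambda>w. vec_lambda (\<lambda>j. U w $ j))"
    by simp
  also have "\<dots> = distr (distr M (\<Pi>\<^sub>M i\<in>UNIV. borel) (\<lambda>w. \<lambda>j\<in>UNIV. U w $ j)) borel vec_lambda"
    using mU mv by (subst distr_distr) (auto simp: comp_def restrict_UNIV)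
  also have "distr M (\<Pi>\<^sub>M i\<in>UNIV. borel) (\<lambda>w. \<lambda>j\<in>UNIV. U w $ j) = (\<Pi>\<^sub>M j\<in>UNIV. distr M borel (\<lambda>w. U w $ j))"
    using ind by (subst indep_vars_iff_distr_eq_PiM'[symmetric]) auto
  also have "\<dots> = density (\<Pi>\<^sub>M i\<in>UNIV. lborel) (\<lambda>x. \<Prod>i\<in>UNIV. ennreal (cn01_density (x i)))"
    unfolding dj by (rule PiM_density_lborel[OF _ ps]) simp
  also have "\<dots> = density (\<Pi>\<^sub>M i\<in>UNIV. lborel)
      (\<lambda>x. ennreal (exp (- (norm (vec_lambda x :: complex ^ 'm))\<^sup>2) / pi ^ CARD('m)))"
    by (simp add: prod_cn01_density[symmetric] prod_ennreal cn01_density_def)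
  also have "distr \<dots> borel vec_lambda = density (distr (\<Pi>\<^sub>M i\<in>UNIV. lborel) borel vec_lambda)
      (\<lambda>u :: complex ^ 'm. ennreal (exp (- (norm u)\<^sup>2) / pi ^ CARD('m)))"
    using mvl by (subst density_distr) auto
  finally show ?thesis
    by (simp add: lborel_vec_eq_distr_PiM[symmetric] cn_vec_def)
qed

text \<open>Lebesgue measure is invariant under \<open>T\<close>, and so is the density, being a
  function of the norm.\<close>

lemma distr_cn_vec_orthogonal:
  fixes T :: "complex ^ 'm \<Rightarrow> complex ^ 'm"
  assumes "orthogonal_transformation T"
  shows "distr cn_vec borel T = cn_vec"
proof -
  have nT: "norm (T v) = norm v" for v
    using assms by (auto simp: orthogonal_transformation)
  have [measurable]: "T \<in> borel_measurable borel"
    by (rule borel_measurable_orthogonal_transformation[OF assms])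
  have "cn_vec = density (distr lborel borel T) (\<lambda>u. ennreal (exp (- (norm u)\<^sup>2) / pi ^ CARD('m)))"
    by (simp add: lborel_distr_orthogonal_transformation[OF assms] cn_vec_def)
  also have "\<dots> = distr cn_vec borel T"
    by (subst density_distr) (auto simp: cn_vec_def nT)
  finally show ?thesis by simp
qed

text \<open>The map is multiplication by the square matrix whose rows are the beams. Orthonormal
  rows force orthonormal columns, and the latter is what preservation of the norm requires.\<close>

lemma orthogonal_transformation_beams:
  fixes b :: "'m::finite \<Rightarrow> complex ^ 'm"
  assumes b: "orthonormal_beams b"
  shows "orthogonal_transformation (\<lambda>u. \<chi> k. tdot u (b k))"
  unfolding orthogonal_transformation
proof safe
  show "linear (\<lambda>u. \<chi> k. tdot u (b k))"
    by (rule linearI) (auto simp: vec_eq_iff tdot_def algebra_simps sum.distrib scaleR_sum_right)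
next
  fix u :: "complex ^ 'm"
  define A :: "complex ^ 'm ^ 'm" where "A = (\<chi> k j. b k $ j)"
  define H :: "complex ^ 'm ^ 'm" where "H = (\<chi> j k. cnj (b k $ j))"
  have "A ** H = mat 1"
    using b by (simp add: vec_eq_iff A_def H_def matrix_matrix_mult_def mat_def orthonormal_beams_def)
  \<comment> \<open>For square matrices a right inverse is also a left inverse; this passes from
    rows to columns.\<close>
  then have "H ** A = mat 1" using matrix_left_right_inverse by blast
  then have col: "(\<Sum>k\<in>UNIV. cnj (b k $ l) * b k $ j) = (if l = j then 1 else 0)" for l j
    by (simp add: vec_eq_iff A_def H_def matrix_matrix_mult_def mat_def)
  have "of_real ((norm (\<chi> k. tdot u (b k)))\<^sup>2) = (\<Sum>k\<in>UNIV. tdot u (b k) * cnj (tdot u (b k)))"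
    by (simp add: norm_vec_def L2_set_def sum_nonneg complex_norm_square del: of_real_power)
  also have "\<dots> = (\<Sum>k\<in>UNIV. \<Sum>j\<in>UNIV. \<Sum>l\<in>UNIV. (u $ j * cnj (u $ l)) * (cnj (b k $ l) * b k $ j))"
    by (simp add: tdot_def sum_product mult_ac)
  also have "\<dots> = (\<Sum>j\<in>UNIV. \<Sum>k\<in>UNIV. \<Sum>l\<in>UNIV. (u $ j * cnj (u $ l)) * (cnj (b k $ l) * b k $ j))"
    by (rule sum.swap)
  also have "\<dots> = (\<Sum>j\<in>UNIV. \<Sum>l\<in>UNIV. \<Sum>k\<in>UNIV. (u $ j * cnj (u $ l)) * (cnj (b k $ l) * b k $ j))"
    by (intro sum.cong refl sum.swap)
  also have "\<dots> = (\<Sum>j\<in>UNIV. u $ j * cnj (u $ j))"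
    by (simp add: sum_distrib_left[symmetric] col if_distrib[of "\<lambda>x. _ * x"] cong: if_cong)
  also have "\<dots> = of_real ((norm u)\<^sup>2)"
    by (simp add: norm_vec_def L2_set_def sum_nonneg complex_norm_square del: of_real_power)
  finally have "(norm (\<chi> k. tdot u (b k)))\<^sup>2 = (norm u)\<^sup>2"
    using of_real_eq_iff by blast
  then show "norm (\<chi> k. tdot u (b k)) = norm u" by simp
qed

section \<open>Tail and Laplace transform of the squared modulus of a complex Gaussian\<close>

lemma nn_integral_exp_linear_tail:
  fixes c t :: real
  assumes c: "c > 0"
  shows "(\<integral>\<^sup>+s. ennreal (c * exp (- c * s) * (s - t)) * indicator {t..} s \<partial>lborel) = ennreal (exp (- c * t) / c)"
proof -
  \<comment> \<open>The function is the antiderivative of the integrand that vanishes at infinity.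
    The factor \<open>s - t\<close> will be, up to pi, the area of an annulus.\<close>
  have lim: "((\<lambda>s. - (s - t + 1 / c) * exp (- c * s)) \<longlongrightarrow> 0) at_top"
    using c by real_asymp
  have "(\<integral>\<^sup>+s. ennreal (c * exp (- c * s) * (s - t)) * indicator {t..} s \<partial>lborel)
      = ennreal (0 - (- (t - t + 1 / c) * exp (- c * t)))"
    using c by (intro nn_integral_FTC_atLeast lim)
      (auto intro!: derivative_eq_intros simp: field_simps)
  then show ?thesis using c by simp
qed

lemma emeasure_lborel_annulus_complex:
  assumes "0 \<le> t"
  shows "emeasure lborel {z::complex. t < (cmod z)\<^sup>2 \<and> (cmod z)\<^sup>2 < s} = ennreal (pi * (s - t))"
proof (cases "t < s")
  case True
  have sq1: "t < (cmod z)\<^sup>2 \<longleftrightarrow> sqrt t < cmod z" and sq2: "(cmod z)\<^sup>2 < s \<longleftrightarrow> cmod z < sqrt s" for z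
    by (metis abs_norm_cancel real_sqrt_abs real_sqrt_less_iff)+
  have "{z::complex. t < (cmod z)\<^sup>2 \<and> (cmod z)\<^sup>2 < s} = ball 0 (sqrt s) - cball 0 (sqrt t)"
    by (auto simp: sq1 sq2)
  also have "emeasure lborel \<dots> = emeasure lborel (ball (0::complex) (sqrt s)) - emeasure lborel (cball (0::complex) (sqrt t))"
    using True assms emeasure_lborel_cball_finite[of "0::complex" "sqrt t"]
    by (intro emeasure_Diff) (auto simp: cball_subset_ball_iff)
  also have "\<dots> = ennreal (pi * s) - ennreal (pi * t)"
    using True assms by (simp add: emeasure_ball emeasure_cball unit_ball_vol_2)
  also have "\<dots> = ennreal (pi * (s - t))"
    using assms by (subst ennreal_minus) (auto simp: algebra_simps)
  finally show ?thesis .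
next
  case False
  then have "\<not> (t < r \<and> r < s)" for r by linarith
  then have "{z::complex. t < (cmod z)\<^sup>2 \<and> (cmod z)\<^sup>2 < s} = {}" by blast
  \<comment> \<open>\<open>ennreal\<close> sends negative reals to 0, in agreement with the empty
    annulus; hence the formula may be used for every \<open>s\<close> under an integral.\<close>
  moreover have "ennreal (pi * (s - t)) = 0"
    using False by (intro ennreal_neg mult_nonneg_nonpos) auto
  ultimately show ?thesis by (simp only: emeasure_empty)
qed

text \<open>Layer-cake: \<open>exp (- c * r)\<close> is the mass of \<open>{r<..}\<close> under the exponential distribution.\<close>

lemma nn_integral_gaussian_complex_tail:
  fixes c t :: real
  assumes c: "c > 0" and t: "t \<ge> 0"
  shows "(\<integral>\<^sup>+z. ennreal (exp (- c * (cmod z)\<^sup>2)) * indicator {z. t < (cmod z)\<^sup>2} z \<partial>lborel)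
           = ennreal (pi * exp (- c * t) / c)"
proof -
  have exp_tail: "ennreal (exp (- c * r)) = (\<integral>\<^sup>+s. ennreal (c * exp (- c * s)) * indicator {r<..} s \<partial>lborel)" for r
  proof -
    have lim: "((\<lambda>s. - exp (- c * s)) \<longlongrightarrow> 0) at_top" using c by real_asymp
    have "(\<integral>\<^sup>+s. ennreal (c * exp (- c * s)) * indicator {r<..} s \<partial>lborel) = 
      (\<integral>\<^sup>+s. ennreal (c * exp (- c * s)) * indicator {r..} s \<partial>lborel)"
      using AE_lborel_singleton[of r]
      by (intro nn_integral_cong_AE) (auto elim!: eventually_mono simp: indicator_def)
    also have "\<dots> = ennreal (0 - (- exp (- c * r)))"
      using c by (intro nn_integral_FTC_atLeast lim) (auto intro!: derivative_eq_intros)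
    finally show ?thesis by simp
  qed
  have "(\<integral>\<^sup>+z. ennreal (exp (- c * (cmod z)\<^sup>2)) * indicator {z. t < (cmod z)\<^sup>2} z \<partial>lborel)
    = (\<integral>\<^sup>+z. \<integral>\<^sup>+s. ennreal (c * exp (- c * s)) *
          (if t < (cmod z)\<^sup>2 \<and> (cmod z)\<^sup>2 < s then 1 else 0) \<partial>lborel \<partial>lborel)"
    unfolding exp_tail
    by (intro nn_integral_cong, subst nn_integral_multc[symmetric])
       (auto intro!: nn_integral_cong simp: indicator_def)
  also have "\<dots> = (\<integral>\<^sup>+s. \<integral>\<^sup>+z. ennreal (c * exp (- c * s)) *
          (if t < (cmod z)\<^sup>2 \<and> (cmod z)\<^sup>2 < s then 1 else 0) \<partial>lborel \<partial>lborel)"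
    by (rule lborel_pair.Fubini') measurable
  also have "\<dots> = (\<integral>\<^sup>+s. ennreal (c * exp (- c * s)) * ennreal (pi * (s - t)) \<partial>lborel)"
  proof (intro nn_integral_cong)
    fix s :: real
    have "(\<integral>\<^sup>+z. (if t < (cmod z)\<^sup>2 \<and> (cmod z)\<^sup>2 < s then 1 else 0) \<partial>lborel) =
       (\<integral>\<^sup>+z. indicator {z::complex. t < (cmod z)\<^sup>2 \<and> (cmod z)\<^sup>2 < s} z \<partial>lborel)"
      by (intro nn_integral_cong) (auto simp: indicator_def)
    also have "\<dots> = ennreal (pi * (s - t))"
      by (subst nn_integral_indicator) (auto simp: emeasure_lborel_annulus_complex[OF t])
    finally show "(\<integral>\<^sup>+z. ennreal (c * exp (- c * s)) *
          (if t < (cmod z)\<^sup>2 \<and> (cmod z)\<^sup>2 < s then 1 else 0) \<partial>lborel) =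
       ennreal (c * exp (- c * s)) * ennreal (pi * (s - t))"
      by (subst nn_integral_cmult) auto
  qed
  \<comment> \<open>For \<open>s < t\<close> the truncated area is 0, which the indicator now
    records.\<close>
  also have "\<dots> = (\<integral>\<^sup>+s. ennreal pi * (ennreal (c * exp (- c * s) * (s - t)) * indicator {t..} s) \<partial>lborel)"
    using c by (intro nn_integral_cong)
      (auto simp: indicator_def ennreal_mult'[symmetric] mult_ac not_le ennreal_neg mult_nonneg_nonpos2
         mult_nonneg_nonpos)
  also have "\<dots> = ennreal pi * ennreal (exp (- c * t) / c)"
    by (subst nn_integral_cmult) (use nn_integral_exp_linear_tail[OF c, of t] in auto)
  also have "\<dots> = ennreal (pi * exp (- c * t) / c)"
    using c by (simp add: ennreal_mult[symmetric])
  finally show ?thesis .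
qed

text \<open>Identifies the power of one Gaussian coefficient as a unit exponential variable.\<close>

lemma emeasure_cn01_tail:
  assumes t: "t \<ge> 0"
  shows "emeasure (density lborel (\<lambda>z. ennreal (cn01_density z))) {z. t < (cmod z)\<^sup>2} = ennreal (exp (- t))"
proof -
  have "emeasure (density lborel (\<lambda>z. ennreal (cn01_density z))) {z. t < (cmod z)\<^sup>2}
     = (\<integral>\<^sup>+z. ennreal (1 / pi) * (ennreal (exp (- 1 * (cmod z)\<^sup>2)) * indicator {z. t < (cmod z)\<^sup>2} z) \<partial>lborel)"
    by (subst emeasure_density)
       (auto intro!: nn_integral_cong simp: cn01_density_def indicator_def ennreal_mult[symmetric])
  also have "\<dots> = ennreal (1 / pi) * ennreal (pi * exp (- 1 * t) / 1)"
    by (subst nn_integral_cmult) (use nn_integral_gaussian_complex_tail[OF _ t, of 1] in auto)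
  also have "\<dots> = ennreal (exp (- t))"
    by (simp add: ennreal_mult[symmetric])
  finally show ?thesis .
qed

text \<open>The extra exponential merges with the density into a Gaussian of rate
  \<open>1 + s\<close>. The result is the Laplace transform through which each interfering beam
  enters.\<close>

lemma nn_integral_cn01_exp:
  assumes s: "s \<ge> 0"
  shows "(\<integral>\<^sup>+z. ennreal (exp (- s * (cmod z)\<^sup>2)) \<partial>density lborel (\<lambda>z. ennreal (cn01_density z)))
     = ennreal (1 / (1 + s))"
proof -
  have "(\<integral>\<^sup>+z. ennreal (exp (- s * (cmod z)\<^sup>2)) \<partial>density lborel (\<lambda>z. ennreal (cn01_density z)))
     = (\<integral>\<^sup>+z. ennreal (1 / pi) * (ennreal (exp (- (1 + s) * (cmod z)\<^sup>2)) * indicator {z. 0 < (cmod z)\<^sup>2} z) \<partial>lborel)"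
    using AE_lborel_singleton[of "0::complex"]
    by (subst nn_integral_density, simp, simp, intro nn_integral_cong_AE)
       (auto elim!: eventually_mono simp: cn01_density_def indicator_def ennreal_mult[symmetric]
          exp_add[symmetric] algebra_simps)
  also have "\<dots> = ennreal (1 / pi) * ennreal (pi * exp (- (1 + s) * 0) / (1 + s))"
    using s by (subst nn_integral_cmult) (use nn_integral_gaussian_complex_tail[of "1 + s" 0] in auto)
  also have "\<dots> = ennreal (1 / (1 + s))"
    using s by (simp add: ennreal_mult[symmetric])
  finally show ?thesis .
qed

text \<open>Conditionally on the interference \<open>S\<close> the exponential tail of the signal
  gives \<open>exp (- z * (c + S))\<close>. Its mean factors over the independent interferers, and
  each contributes \<open>1 / (1 + z)\<close>.\<close>

lemma (in prob_space) prob_cn_interference: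
  fixes U :: "'a \<Rightarrow> complex ^ 'm" and m :: 'm
  assumes ind: "indep_vars (\<lambda>_. borel) (\<lambda>j w. U w $ j) UNIV"
    and D: "\<And>j. distributed M lborel (\<lambda>w. U w $ j) (\<lambda>z. ennreal (cn01_density z))"
    and z: "z \<ge> 0" and c: "c \<ge> 0"
  shows "emeasure M {w \<in> space M. z * (c + (\<Sum>k\<in>UNIV - {m}. (cmod (U w $ k))\<^sup>2)) < (cmod (U w $ m))\<^sup>2}
      = ennreal (exp (- z * c) / (1 + z) ^ (CARD('m) - 1))"
proof -
  define X where "X = (\<lambda>k w. (cmod (U w $ k))\<^sup>2)"
  define S where "S = (\<lambda>w. \<Sum>k\<in>UNIV - {m}. X k w)"
  have rv[measurable]: "(\<lambda>w. U w $ j) \<in> borel_measurable M" for j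
    using D[of j] by (simp add: distributed_def)
  have dj: "distr M borel (\<lambda>w. U w $ j) = density lborel (\<lambda>z. ennreal (cn01_density z))" for j
    using D[of j] by (simp add: distributed_def cong: distr_cong)
  have X[measurable]: "X k \<in> borel_measurable M" for k
    unfolding X_def by measurable
  have S[measurable]: "S \<in> borel_measurable M"
    unfolding S_def by measurable
  have indX: "indep_vars (\<lambda>_. borel) X UNIV"
    unfolding X_def by (rule indep_vars_compose2[OF ind]) measurable
  have "insert m (UNIV - {m}) = UNIV" by auto
  then have "indep_var borel (X m) borel S"
    unfolding S_def using indX by (intro indep_vars_sum) auto
  then have J: "distr M borel (X m) \<Otimes>\<^sub>M distr M borel S = distr M (borel \<Otimes>\<^sub>M borel) (\<lambda>w. (X m w, S w))"
    by (simp add: indep_var_distribution_eq)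
  interpret DX: prob_space "distr M borel (X m)" by (rule prob_space_distr) simp
  interpret DS: prob_space "distr M borel S" by (rule prob_space_distr) simp
  interpret pair_sigma_finite "distr M borel (X m)" "distr M borel S" ..
  have tail: "emeasure M {w \<in> space M. t < X k w} = ennreal (exp (- t))" if "t \<ge> 0" for t k
  proof -
    have "emeasure M {w \<in> space M. t < X k w} = emeasure (distr M borel (\<lambda>w. U w $ k)) {z. t < (cmod z)\<^sup>2}"
      by (subst emeasure_distr) (auto intro!: arg_cong[where f="emeasure M"] simp: X_def)
    then show ?thesis using emeasure_cn01_tail[OF that] by (simp add: dj)
  qed
  have E: "(\<integral>\<^sup>+w. ennreal (exp (- z * X k w)) \<partial>M) = ennreal (1 / (1 + z))" for k
  proof -
    have "(\<integral>\<^sup>+w. ennreal (exp (- z * X k w)) \<partial>M) =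
      (\<integral>\<^sup>+x. ennreal (exp (- z * (cmod x)\<^sup>2)) \<partial>distr M borel (\<lambda>w. U w $ k))"
      by (subst nn_integral_distr) (auto simp: X_def)
    then show ?thesis using nn_integral_cn01_exp[OF z] by (simp add: dj)
  qed
  let ?A = "{p. z * (c + snd p) < fst p} :: (real \<times> real) set"
  have A: "?A \<in> sets (borel \<Otimes>\<^sub>M borel)"
  proof -
    have "{p \<in> space (borel \<Otimes>\<^sub>M borel). z * (c + snd p) < fst p} \<in> sets (borel \<Otimes>\<^sub>M (borel :: real measure))"
      by measurable
    then show ?thesis by (simp add: space_pair_measure)
  qed
  have "{w \<in> space M. z * (c + (\<Sum>k\<in>UNIV - {m}. (cmod (U w $ k))\<^sup>2)) < (cmod (U w $ m))\<^sup>2} =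
      (\<lambda>w. (X m w, S w)) -` ?A \<inter> space M"
    by (auto simp: X_def S_def)
  then have "emeasure M {w \<in> space M. z * (c + (\<Sum>k\<in>UNIV - {m}. (cmod (U w $ k))\<^sup>2)) < (cmod (U w $ m))\<^sup>2}
     = emeasure (distr M (borel \<Otimes>\<^sub>M borel) (\<lambda>w. (X m w, S w))) ?A"
    using A by (subst emeasure_distr) auto
  also have "\<dots> = (\<integral>\<^sup>+s. emeasure (distr M borel (X m)) ((\<lambda>x. (x, s)) -` ?A) \<partial>distr M borel S)"
    unfolding J[symmetric]
    by (rule emeasure_pair_measure_alt2) (use A in \<open>simp cong: sets_pair_measure_cong\<close>)
  also have "\<dots> = (\<integral>\<^sup>+s. emeasure M {w \<in> space M. z * (c + s) < X m w} \<partial>distr M borel S)"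
    by (intro nn_integral_cong, subst emeasure_distr) (auto intro!: arg_cong[where f="emeasure M"])
  also have "\<dots> = (\<integral>\<^sup>+s. ennreal (exp (- z * c)) * ennreal (exp (- z * s)) \<partial>distr M borel S)"
  proof (rule nn_integral_cong_AE)
    \<comment> \<open>The tail formula holds at nonnegative thresholds only, so the sign of the
      interference matters.\<close>
    have "AE s in distr M borel S. s \<ge> 0"
      by (subst AE_distr_iff) (auto simp: S_def X_def sum_nonneg)
    then show "AE s in distr M borel S. emeasure M {w \<in> space M. z * (c + s) < X m w} =
       ennreal (exp (- z * c)) * ennreal (exp (- z * s))"
    proof eventually_elim
      case (elim s)
      then show ?case using z c
        by (subst tail) (auto simp: ennreal_mult[symmetric] exp_add[symmetric] algebra_simps)
    qed
  qed
  also have "\<dots> = ennreal (exp (- z * c)) * (\<integral>\<^sup>+w. ennreal (exp (- z * S w)) \<partial>M)"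
    by (subst nn_integral_cmult, simp, subst nn_integral_distr) auto
  also have "(\<integral>\<^sup>+w. ennreal (exp (- z * S w)) \<partial>M) = (\<integral>\<^sup>+w. (\<Prod>k\<in>UNIV - {m}. ennreal (exp (- z * X k w))) \<partial>M)"
    by (intro nn_integral_cong)
       (simp add: S_def prod_ennreal exp_sum[symmetric] sum_distrib_left sum_negf)
  also have "\<dots> = (\<Prod>k\<in>UNIV - {m}. \<integral>\<^sup>+w. ennreal (exp (- z * X k w)) \<partial>M)"
  proof (rule indep_vars_nn_integral)
    have "indep_vars (\<lambda>_. borel) X (UNIV - {m})"
      using indX by (rule indep_vars_subset) auto
    then show "indep_vars (\<lambda>_. borel) (\<lambda>k w. ennreal (exp (- z * X k w))) (UNIV - {m})"
      by (rule indep_vars_compose2) measurable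
  qed auto
  also have "\<dots> = ennreal ((1 / (1 + z)) ^ (CARD('m) - 1))"
    unfolding E using z by (simp add: card_Diff_singleton ennreal_power)
  also have "ennreal (exp (- z * c)) * \<dots> = ennreal (exp (- z * c) / (1 + z) ^ (CARD('m) - 1))"
    using z by (simp add: ennreal_mult[symmetric] power_one_over)
  finally show ?thesis .
qed

lemma vec_nth_borel_measurable:
  "(\<lambda>v. v $ j) \<in> borel_measurable (borel :: ('a::euclidean_space ^ 'm) measure)"
  by (intro borel_measurable_continuous_onI continuous_on_component continuous_on_id)

lemma measurable_tdot[measurable (raw)]:
  fixes u v :: "'a \<Rightarrow> complex ^ 'm"
  assumes "u \<in> borel_measurable M" "v \<in> borel_measurable M"
  shows "(\<lambda>x. tdot (u x) (v x)) \<in> borel_measurable M"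
proof -
  have [measurable]: "(\<lambda>x. u x $ j) \<in> borel_measurable M" "(\<lambda>x. v x $ j) \<in> borel_measurable M" for j
    by (rule measurable_compose[OF assms(1) vec_nth_borel_measurable], rule measurable_compose[OF assms(2) vec_nth_borel_measurable])
  show ?thesis unfolding tdot_def by measurable
qed

text \<open>The coefficients of a Gaussian vector along fixed orthonormal beams are jointly
  distributed like its entries, so the previous computation applies. The variable \<open>U\<close>
  realises \<open>cn_vec\<close> with independent entries.\<close>

lemma (in prob_space) measure_cn_vec_sinr_le:
  fixes U :: "'a \<Rightarrow> complex ^ 'm" and b :: "'m \<Rightarrow> complex ^ 'm"
  assumes ind: "indep_vars (\<lambda>_. borel) (\<lambda>j w. U w $ j) UNIV"
    and D: "\<And>j. distributed M lborel (\<lambda>w. U w $ j) (\<lambda>z. ennreal (cn01_density z))"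
    and U[measurable]: "U \<in> borel_measurable M"
    and b: "orthonormal_beams b"
    and z: "z \<ge> 0" and rho: "\<rho> > 0" and g: "g > 0"
  shows "measure cn_vec {u. sinr \<rho> g u b m \<le> z} = 1 - exp (- z / (\<rho> * g)) / (1 + z) ^ (CARD('m) - 1)"
proof -
  define c where "c = inverse (\<rho> * g)"
  have c: "c > 0" using rho g by (simp add: c_def)
  define T where "T = (\<lambda>u. \<chi> k. tdot u (b k))"
  have oT: "orthogonal_transformation T"
    unfolding T_def by (rule orthogonal_transformation_beams[OF b])
  have Tm[measurable]: "T \<in> borel_measurable borel"
    by (rule borel_measurable_orthogonal_transformation[OF oT])
  have distr: "distr M borel U = cn_vec" by (rule distr_cn_vec[OF ind D])
  interpret C: prob_space "cn_vec :: (complex ^ 'm) measure"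
    unfolding distr[symmetric] by (rule prob_space_distr) simp
  define E where "E = {v :: complex ^ 'm. z * (c + (\<Sum>k\<in>UNIV - {m}. (cmod (v $ k))\<^sup>2)) < (cmod (v $ m))\<^sup>2}"
  note vec_nth_borel_measurable[measurable]
  have E[measurable]: "E \<in> sets borel"
    unfolding E_def by measurable
  have "{u. z < sinr \<rho> g u b m} = T -` E"
  proof (intro set_eqI)
    fix u
    \<comment> \<open>The noise term keeps the denominator positive, so the inequality may be
      cross-multiplied.\<close>
    have "0 < c + (\<Sum>k\<in>UNIV - {m}. (cmod (tdot u (b k)))\<^sup>2)"
      using c by (simp add: add_pos_nonneg sum_nonneg)
    then show "u \<in> {u. z < sinr \<rho> g u b m} \<longleftrightarrow> u \<in> T -` E"
      by (simp add: sinr_def E_def T_def c_def pos_less_divide_eq)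
  qed
  then have "emeasure cn_vec {u. z < sinr \<rho> g u b m} = emeasure (distr cn_vec borel T) E"
    by (simp add: emeasure_distr)
  also have "\<dots> = emeasure (distr M borel U) E"
    by (simp add: distr_cn_vec_orthogonal[OF oT] distr)
  also have "\<dots> = emeasure M {w \<in> space M. z * (c + (\<Sum>k\<in>UNIV - {m}. (cmod (U w $ k))\<^sup>2)) < (cmod (U w $ m))\<^sup>2}"
    by (subst emeasure_distr) (auto intro!: arg_cong[where f="emeasure M"] simp: E_def)
  also have "\<dots> = ennreal (exp (- z * c) / (1 + z) ^ (CARD('m) - 1))"
    using c by (intro prob_cn_interference[OF ind D z]) auto
  finally have *: "measure cn_vec {u. z < sinr \<rho> g u b m} = exp (- z / (\<rho> * g)) / (1 + z) ^ (CARD('m) - 1)"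
    using z by (simp add: measure_def c_def field_simps)
  have "{u. sinr \<rho> g u b m \<le> z} = space cn_vec - T -` E"
    using \<open>{u. z < sinr \<rho> g u b m} = T -` E\<close> by (auto simp: set_eq_iff not_less[symmetric])
  moreover have "T -` E \<in> sets cn_vec" using measurable_sets[OF Tm E] by simp
  ultimately have "measure cn_vec {u. sinr \<rho> g u b m \<le> z} = 1 - measure cn_vec (T -` E)"
    using C.prob_compl by simp
  then show ?thesis using * \<open>{u. z < sinr \<rho> g u b m} = T -` E\<close> by simp
qed

section \<open>Radial functionals of a planar Poisson process\<close>

text \<open>The generating function of a Poisson variable, from the exponential series. Mean 0 is
  included because the annuli degenerate at \<open>D = 0\<close>.\<close>

lemma (in prob_space) nn_integral_power_poisson:
  fixes N :: "'a \<Rightarrow> nat"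
  assumes N[measurable]: "N \<in> measurable M (count_space UNIV)"
    and p: "\<And>n. measure M {w \<in> space M. N w = n} = \<mu> ^ n / fact n * exp (- \<mu>)"
    and mu: "\<mu> \<ge> 0" and q: "q \<ge> 0"
  shows "(\<integral>\<^sup>+w. ennreal (q ^ N w) \<partial>M) = ennreal (exp (- (\<mu> * (1 - q))))"
proof -
  have d: "distr M (count_space UNIV) N = density (count_space UNIV) (\<lambda>n. ennreal (\<mu> ^ n / fact n * exp (- \<mu>)))"
  proof (rule measure_eqI_countable[of _ UNIV])
    fix n :: nat
    have "emeasure (distr M (count_space UNIV) N) {n} = emeasure M {w \<in> space M. N w = n}"
      by (subst emeasure_distr) (auto intro!: arg_cong[where f="emeasure M"])
    also have "\<dots> = ennreal (\<mu> ^ n / fact n * exp (- \<mu>))"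
      by (simp add: emeasure_eq_measure p)
    also have "\<dots> = emeasure (density (count_space UNIV) (\<lambda>n. ennreal (\<mu> ^ n / fact n * exp (- \<mu>)))) {n}"
      by (simp add: emeasure_density nn_integral_count_space_indicator[symmetric])
    finally show "emeasure (distr M (count_space UNIV) N) {n} =
      emeasure (density (count_space UNIV) (\<lambda>n. ennreal (\<mu> ^ n / fact n * exp (- \<mu>)))) {n}" .
  qed auto
  have s: "(\<lambda>n. \<mu> ^ n / fact n * exp (- \<mu>) * q ^ n) sums (exp (- \<mu>) * exp (\<mu> * q))"
    using sums_mult[OF exp_converges[of "\<mu> * q"], of "exp (- \<mu>)"]
    by (simp add: power_mult_distrib field_simps)
  have "(\<integral>\<^sup>+w. ennreal (q ^ N w) \<partial>M) = (\<integral>\<^sup>+n. ennreal (q ^ n) \<partial>distr M (count_space UNIV) N)"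
    by (subst nn_integral_distr) auto
  also have "\<dots> = (\<integral>\<^sup>+n. ennreal (\<mu> ^ n / fact n * exp (- \<mu>) * q ^ n) \<partial>count_space UNIV)"
    unfolding d using mu q
    by (subst nn_integral_density) (auto intro!: nn_integral_cong simp: ennreal_mult[symmetric])
  also have "\<dots> = (\<Sum>n. ennreal (\<mu> ^ n / fact n * exp (- \<mu>) * q ^ n))"
    by (rule nn_integral_count_space_nat)
  also have "\<dots> = ennreal (exp (- \<mu>) * exp (\<mu> * q))"
    using mu q by (intro suminf_ennreal_eq s) auto
  also have "exp (- \<mu>) * exp (\<mu> * q) = exp (- (\<mu> * (1 - q)))"
    by (simp add: exp_add[symmetric] algebra_simps)
  finally show ?thesis .
qed

text \<open>On each strip a decreasing function lies between its values at the two ends; induction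
  adds one strip at a time.\<close>

lemma antimono_integral_equipartition_bounds:
  fixes \<phi> :: "real \<Rightarrow> real"
  assumes anti: "\<And>s t. 0 \<le> s \<Longrightarrow> s \<le> t \<Longrightarrow> \<phi> t \<le> \<phi> s"
    and int: "\<And>t. \<phi> integrable_on {0..t}" and d: "\<delta> \<ge> 0"
  shows "\<delta> * (\<Sum>j<n. \<phi> (real (Suc j) * \<delta>)) \<le> integral {0..real n * \<delta>} \<phi> \<and>
         integral {0..real n * \<delta>} \<phi> \<le> \<delta> * (\<Sum>j<n. \<phi> (real j * \<delta>))"
proof (induction n)
  case (Suc n)
  let ?a = "real n * \<delta>" and ?b = "real (Suc n) * \<delta>"
  have ab: "0 \<le> ?a" "?a \<le> ?b" using d by (auto simp: algebra_simps)
  have int': "\<phi> integrable_on {?a..?b}"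
    using int[of ?b] ab by (auto intro: integrable_subinterval_real)
  have split: "integral {0..?a} \<phi> + integral {?a..?b} \<phi> = integral {0..?b} \<phi>"
    using ab int by (intro Henstock_Kurzweil_Integration.integral_combine) auto
  have const: "integral {?a..?b} (\<lambda>_. c) = \<delta> * c" for c :: real
    using ab(2) by (simp add: algebra_simps)
  have lo: "\<delta> * \<phi> ?b \<le> integral {?a..?b} \<phi>"
    unfolding const[symmetric] using ab anti by (intro integral_le int') auto
  have hi: "integral {?a..?b} \<phi> \<le> \<delta> * \<phi> ?a"
    unfolding const[symmetric] using ab anti by (intro integral_le int') auto
  show ?case
    unfolding sum.lessThan_Suc distrib_left using Suc split lo hi by linarith
qed simp

text \<open>All annuli have area \<open>pi * \<delta>\<close>; the innermost one is a full disk, so that users located at the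
  origin are counted.\<close>

definition annulus :: "real \<Rightarrow> nat \<Rightarrow> (real ^ 2) set" where
  "annulus \<delta> j = cball 0 (sqrt (real (Suc j) * \<delta>)) - (if j = 0 then {} else cball 0 (sqrt (real j * \<delta>)))"

lemma mem_annulus:
  assumes "\<delta> \<ge> 0"
  shows "x \<in> annulus \<delta> j \<longleftrightarrow> (norm x)\<^sup>2 \<le> real (Suc j) * \<delta> \<and> (j = 0 \<or> real j * \<delta> < (norm x)\<^sup>2)"
proof -
  have "norm x \<le> sqrt t \<longleftrightarrow> (norm x)\<^sup>2 \<le> t" for t
    by (metis abs_norm_cancel real_sqrt_abs real_sqrt_le_iff)
  then show ?thesis by (simp add: annulus_def not_le del: of_nat_Suc)
qed

lemma annulus_bounds:
  assumes "\<delta> \<ge> 0" "x \<in> annulus \<delta> j"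
  shows "real j * \<delta> \<le> (norm x)\<^sup>2" "(norm x)\<^sup>2 \<le> real (Suc j) * \<delta>"
  using assms(2) unfolding mem_annulus[OF assms(1)] by auto

lemma annulus_disjoint:
  assumes d: "\<delta> \<ge> 0" and "i < j"
  shows "annulus \<delta> i \<inter> annulus \<delta> j = {}"
proof -
  have "real (Suc i) * \<delta> \<le> real j * \<delta>" using assms by (intro mult_right_mono) auto
  then have "x \<notin> annulus \<delta> i" if "x \<in> annulus \<delta> j" for x
    using that \<open>i < j\<close> unfolding mem_annulus[OF d] by (metis not_less_zero order_trans not_le)
  then show ?thesis by blast
qed

lemma disjoint_family_annulus: "\<delta> \<ge> 0 \<Longrightarrow> disjoint_family_on (annulus \<delta>) I"
  unfolding disjoint_family_on_def
proof (intro ballI impI)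
  fix i j :: nat assume "\<delta> \<ge> 0" "i \<noteq> j"
  then show "annulus \<delta> i \<inter> annulus \<delta> j = {}"
    using annulus_disjoint[of \<delta> i j] annulus_disjoint[of \<delta> j i]
    by (cases i j rule: linorder_cases) (simp_all add: Int_commute)
qed

lemma UN_annulus:
  assumes d: "\<delta> \<ge> 0" and "n > 0"
  shows "(\<Union>j<n. annulus \<delta> j) = cball 0 (sqrt (real n * \<delta>))"
  using \<open>n > 0\<close>
proof (induction n)
  case (Suc n)
  have "sqrt (real n * \<delta>) \<le> sqrt (real (Suc n) * \<delta>)"
    using d by (intro real_sqrt_le_mono mult_right_mono) auto
  then have "cball 0 (sqrt (real n * \<delta>)) \<subseteq> cball (0::real^2) (sqrt (real (Suc n) * \<delta>))"
    by (rule subset_cball)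
  then show ?case using Suc
    by (cases "n = 0") (auto simp: annulus_def lessThan_Suc)
qed simp

lemma bounded_annulus: "bounded (annulus \<delta> j)"
  using bounded_cball unfolding annulus_def by (rule bounded_subset) (rule Diff_subset)

lemma sets_annulus[measurable]: "annulus \<delta> j \<in> sets borel"
  unfolding annulus_def by auto

lemma measure_annulus:
  assumes d: "\<delta> \<ge> 0"
  shows "measure lborel (annulus \<delta> j) = pi * \<delta>"
proof (cases "j = 0")
  case True
  then show ?thesis using d by (simp add: annulus_def content_cball unit_ball_vol_2)
next
  case False
  have "sqrt (real j * \<delta>) \<le> sqrt (real (Suc j) * \<delta>)"
    using d by (intro real_sqrt_le_mono mult_right_mono) auto
  then have "measure lborel (annulus \<delta> j) = measure lborel (cball (0::real^2) (sqrt (real (Suc j) * \<delta>)))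
     - measure lborel (cball (0::real^2) (sqrt (real j * \<delta>)))"
    using False emeasure_lborel_cball_finite[of "0::real^2" "sqrt (real (Suc j) * \<delta>)"]
    by (simp add: annulus_def measure_Diff subset_cball less_top del: of_nat_Suc)
  then show ?thesis using d by (simp add: content_cball unit_ball_vol_2) (simp add: algebra_simps)
qed

context
  fixes P :: "'w measure" and lam :: real and X :: "nat \<Rightarrow> 'w \<Rightarrow> real ^ 2"
  assumes ppp: "poisson_point_process P lam X"
begin

lemma poisson_finite_users:
  "bounded A \<Longrightarrow> w \<in> space P \<Longrightarrow> finite {i. X i w \<in> A}"
  using ppp[unfolded poisson_point_process_def, THEN conjunct2, THEN conjunct2, THEN conjunct1] by simp

text \<open>Counts in disjoint annuli are independent, so the mean factors into Poisson generating
  functions, all of mean \<open>lam * pi * \<delta>\<close>.\<close>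

lemma nn_integral_annuli_counts:
  assumes lam: "lam \<ge> 0" and d: "\<delta> \<ge> 0" and q: "\<And>j. q j \<ge> 0"
  shows "(\<integral>\<^sup>+w. ennreal (\<Prod>j<n. q j ^ card {i. X i w \<in> annulus \<delta> j}) \<partial>P) =
     ennreal (exp (- lam * pi * \<delta> * (\<Sum>j<n. 1 - q j)))"
proof -
  interpret prob_space P using ppp by (simp add: poisson_point_process_def)
  define N where "N = (\<lambda>j w. card {i. X i w \<in> annulus \<delta> j})"
  have ind: "indep_vars (\<lambda>_. count_space UNIV) N {..<n}"
    using ppp disjoint_family_annulus[OF d] unfolding poisson_point_process_def N_def
    by (auto simp: bounded_annulus)
  have cnt: "measure P {w \<in> space P. N j w = k} = (lam * pi * \<delta>) ^ k / fact k * exp (- (lam * pi * \<delta>))" for j k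
    using ppp unfolding poisson_point_process_def N_def
    by (simp add: bounded_annulus measure_annulus[OF d] mult_ac)
  have "(\<integral>\<^sup>+w. ennreal (\<Prod>j<n. q j ^ N j w) \<partial>P) = (\<integral>\<^sup>+w. (\<Prod>j<n. ennreal (q j ^ N j w)) \<partial>P)"
    using q by (simp add: prod_ennreal)
  also have "\<dots> = (\<Prod>j<n. \<integral>\<^sup>+w. ennreal (q j ^ N j w) \<partial>P)"
    by (rule indep_vars_nn_integral, simp, rule indep_vars_compose2[OF ind]) auto
  also have "\<dots> = (\<Prod>j<n. ennreal (exp (- ((lam * pi * \<delta>) * (1 - q j)))))"
  proof (rule prod.cong)
    fix j assume "j \<in> {..<n}"
    then have "N j \<in> measurable P (count_space UNIV)" using ind by (auto simp: indep_vars_def)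
    then show "(\<integral>\<^sup>+w. ennreal (q j ^ N j w) \<partial>P) = ennreal (exp (- ((lam * pi * \<delta>) * (1 - q j))))"
      using lam d by (intro nn_integral_power_poisson cnt q) auto
  qed simp
  also have "\<dots> = ennreal (exp (- lam * pi * \<delta> * (\<Sum>j<n. 1 - q j)))"
    by (simp add: prod_ennreal exp_sum[symmetric] sum_negf sum_distrib_left)
  finally show ?thesis by (simp add: N_def)
qed

lemma finite_cell_users:
  "w \<in> space P \<Longrightarrow> finite (cell_users X D w)"
  unfolding cell_users_def by (rule poisson_finite_users) simp_all

text \<open>Every user of the cell lies in exactly one annulus. At least one annulus is required:
  the disk contains its centre even at radius 0, whereas an empty union contains nothing.\<close>

lemma prod_cell_users_annuli:
  assumes w: "w \<in> space P" and d: "\<delta> \<ge> 0" and n: "n > 0" and D: "D = sqrt (real n * \<delta>)"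
  shows "(\<Prod>i\<in>cell_users X D w. f i) = (\<Prod>j<n. \<Prod>i\<in>{i. X i w \<in> annulus \<delta> j}. f i)"
proof -
  have "cell_users X D w = (\<Union>j<n. {i. X i w \<in> annulus \<delta> j})"
    using UN_annulus[OF d n] unfolding cell_users_def D by blast
  moreover have "finite {i. X i w \<in> annulus \<delta> j}" for j
    using w bounded_annulus poisson_finite_users by blast
  moreover have "{i. X i w \<in> annulus \<delta> j} \<inter> {i. X i w \<in> annulus \<delta> k} = {}" if "j \<noteq> k" for j k
    using disjoint_family_annulus[OF d, of UNIV] that by (auto simp: disjoint_family_on_def)
  ultimately show ?thesis by (simp add: prod.UNION_disjoint)
qed

text \<open>On an annulus \<open>1 - \<phi>\<close> is smallest at the inner and largest at the
  outer radius. Replacing it by either constant leaves powers of counts, and both resulting means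
  tend to the same limit as the annuli get thinner. Since \<open>nn_integral\<close> is only
  compared, no measurability of the product over a random index set has to be established.\<close>

lemma poisson_radial_laplace_functional:
  fixes \<phi> :: "real \<Rightarrow> real"
  assumes lam: "lam \<ge> 0" and D: "D \<ge> 0"
    and anti: "\<And>s t. 0 \<le> s \<Longrightarrow> s \<le> t \<Longrightarrow> \<phi> t \<le> \<phi> s"
    and int: "\<And>t. \<phi> integrable_on {0..t}"
    and \<phi>01: "\<And>t. 0 \<le> t \<Longrightarrow> 0 \<le> \<phi> t \<and> \<phi> t \<le> 1"
  shows "(\<integral>\<^sup>+w. ennreal (\<Prod>i\<in>cell_users X D w. 1 - \<phi> ((norm (X i w))\<^sup>2)) \<partial>P) =
     ennreal (exp (- lam * pi * integral {0..D\<^sup>2} \<phi>))"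
    (is "?V = ennreal (exp (- lam * pi * ?J))")
proof -
  \<comment> \<open>The total drop of \<open>\<phi>\<close> over the cell: upper and lower Darboux
    sums differ by \<open>k\<close> times the step, because the difference telescopes.\<close>
  define k where "k = \<phi> 0 - \<phi> (D\<^sup>2)"
  \<comment> \<open>With \<open>Suc n\<close> annuli of this step the cell is exhausted exactly, and
    there is always at least one.\<close>
  define \<delta> where "\<delta> = (\<lambda>n. D\<^sup>2 / real (Suc n))"
  have d0: "\<delta> n \<ge> 0" for n by (simp add: \<delta>_def)
  have nd: "real (Suc n) * \<delta> n = D\<^sup>2" for n by (simp add: \<delta>_def)
  have Dn: "D = sqrt (real (Suc n) * \<delta> n)" for n unfolding nd using D by simp
  have tel: "(\<Sum>j<Suc n. \<phi> (real j * \<delta> n)) - (\<Sum>j<Suc n. \<phi> (real (Suc j) * \<delta> n)) = k" for n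
    using sum_lessThan_telescope'[of "\<lambda>j. \<phi> (real j * \<delta> n)" "Suc n"]
    by (simp only: sum_subtractf[symmetric] k_def nd) simp
  have lower: "\<delta> n * (\<Sum>j<Suc n. \<phi> (real j * \<delta> n)) \<le> ?J + k * \<delta> n"
    and upper: "?J - k * \<delta> n \<le> \<delta> n * (\<Sum>j<Suc n. \<phi> (real (Suc j) * \<delta> n))" for n
  proof -
    have "\<delta> n * (\<Sum>j<Suc n. \<phi> (real (Suc j) * \<delta> n)) \<le> ?J \<and> ?J \<le> \<delta> n * (\<Sum>j<Suc n. \<phi> (real j * \<delta> n))"
      using antimono_integral_equipartition_bounds[of \<phi> "\<delta> n" "Suc n", OF anti int d0] unfolding nd .
    moreover have "\<delta> n * (\<Sum>j<Suc n. \<phi> (real j * \<delta> n)) - \<delta> n * (\<Sum>j<Suc n. \<phi> (real (Suc j) * \<delta> n)) = k * \<delta> n"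
      unfolding right_diff_distrib[symmetric] tel by simp
    ultimately show "\<delta> n * (\<Sum>j<Suc n. \<phi> (real j * \<delta> n)) \<le> ?J + k * \<delta> n"
      and "?J - k * \<delta> n \<le> \<delta> n * (\<Sum>j<Suc n. \<phi> (real (Suc j) * \<delta> n))"
      by linarith+
  qed
  have fin: "finite {i. X i w \<in> annulus (\<delta> n) j}" if "w \<in> space P" for w n j
    using that bounded_annulus poisson_finite_users by blast
  have V_ge: "ennreal (exp (- lam * pi * (?J + k * \<delta> n))) \<le> ?V" for n
  proof -
    have "ennreal (exp (- lam * pi * (?J + k * \<delta> n))) \<le>
        ennreal (exp (- lam * pi * \<delta> n * (\<Sum>j<Suc n. 1 - (1 - \<phi> (real j * \<delta> n)))))"
      using lower[of n] lam mult_left_mono[OF lower[of n], of "lam * pi"]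
      by (intro ennreal_leI) (simp add: mult_ac)
    also have "\<dots> = (\<integral>\<^sup>+w. ennreal (\<Prod>j<Suc n. (1 - \<phi> (real j * \<delta> n)) ^ card {i. X i w \<in> annulus (\<delta> n) j}) \<partial>P)"
      using \<phi>01 d0 by (intro nn_integral_annuli_counts[symmetric] lam) auto
    also have "\<dots> \<le> ?V"
    proof (intro nn_integral_mono ennreal_leI)
      fix w assume w: "w \<in> space P"
      have "(\<Prod>j<Suc n. (1 - \<phi> (real j * \<delta> n)) ^ card {i. X i w \<in> annulus (\<delta> n) j}) \<le>
         (\<Prod>j<Suc n. \<Prod>i\<in>{i. X i w \<in> annulus (\<delta> n) j}. 1 - \<phi> ((norm (X i w))\<^sup>2))"
        unfolding prod_constant[symmetric] using \<phi>01 d0 anti annulus_bounds[OF d0]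
        by (intro prod_mono conjI prod_nonneg) auto
      then show "(\<Prod>j<Suc n. (1 - \<phi> (real j * \<delta> n)) ^ card {i. X i w \<in> annulus (\<delta> n) j}) \<le>
         (\<Prod>i\<in>cell_users X D w. 1 - \<phi> ((norm (X i w))\<^sup>2))"
        unfolding prod_cell_users_annuli[OF w d0 zero_less_Suc Dn[of n]] .
    qed
    finally show ?thesis .
  qed
  have V_le: "?V \<le> ennreal (exp (- lam * pi * (?J - k * \<delta> n)))" for n
  proof -
    have "?V \<le> (\<integral>\<^sup>+w. ennreal (\<Prod>j<Suc n. (1 - \<phi> (real (Suc j) * \<delta> n)) ^ card {i. X i w \<in> annulus (\<delta> n) j}) \<partial>P)"
    proof (intro nn_integral_mono ennreal_leI)
      fix w assume w: "w \<in> space P"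
      have "(\<Prod>j<Suc n. \<Prod>i\<in>{i. X i w \<in> annulus (\<delta> n) j}. 1 - \<phi> ((norm (X i w))\<^sup>2)) \<le>
        (\<Prod>j<Suc n. (1 - \<phi> (real (Suc j) * \<delta> n)) ^ card {i. X i w \<in> annulus (\<delta> n) j})"
        unfolding prod_constant[symmetric] using \<phi>01 d0 anti annulus_bounds[OF d0]
        by (intro prod_mono conjI prod_nonneg) auto
      then show "(\<Prod>i\<in>cell_users X D w. 1 - \<phi> ((norm (X i w))\<^sup>2)) \<le>
        (\<Prod>j<Suc n. (1 - \<phi> (real (Suc j) * \<delta> n)) ^ card {i. X i w \<in> annulus (\<delta> n) j})"
        unfolding prod_cell_users_annuli[OF w d0 zero_less_Suc Dn[of n]] .
    qed
    also have "\<dots> = ennreal (exp (- lam * pi * \<delta> n * (\<Sum>j<Suc n. 1 - (1 - \<phi> (real (Suc j) * \<delta> n)))))"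
      using \<phi>01 d0 by (intro nn_integral_annuli_counts lam) auto
    also have "\<dots> \<le> ennreal (exp (- lam * pi * (?J - k * \<delta> n)))"
      using lam mult_left_mono[OF upper[of n], of "lam * pi"]
      by (intro ennreal_leI) (simp add: mult_ac)
    finally show ?thesis .
  qed
  have "\<delta> \<longlonglongrightarrow> 0" unfolding \<delta>_def by real_asymp
  then have l: "(\<lambda>n. ennreal (exp (- lam * pi * (?J + k * \<delta> n)))) \<longlonglongrightarrow> ennreal (exp (- lam * pi * (?J + k * 0)))"
    and u: "(\<lambda>n. ennreal (exp (- lam * pi * (?J - k * \<delta> n)))) \<longlonglongrightarrow> ennreal (exp (- lam * pi * (?J - k * 0)))"
    by (intro tendsto_intros \<open>\<delta> \<longlonglongrightarrow> 0\<close>)+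
  show ?thesis
  proof (rule antisym)
    show "?V \<le> ennreal (exp (- lam * pi * ?J))"
      using LIMSEQ_le_const[OF u, of ?V] V_le by simp
    show "ennreal (exp (- lam * pi * ?J)) \<le> ?V"
      using LIMSEQ_le_const2[OF l, of ?V] V_ge by simp
  qed
qed

end

section \<open>Outage probability of a finite cell\<close>

text \<open>Turns independence of generated sigma-algebras, which allows different value types, into
  a product law to which Fubini applies. Measurable rectangles suffice.\<close>

lemma (in prob_space) distr_pair_indep_set:
  assumes X[measurable]: "X \<in> measurable M N1" and Y[measurable]: "Y \<in> measurable M N2"
    and ind: "indep_set (sets (vimage_algebra (space M) X N1)) (sets (vimage_algebra (space M) Y N2))"
  shows "distr M (N1 \<Otimes>\<^sub>M N2) (\<lambda>w. (X w, Y w)) = distr M N1 X \<Otimes>\<^sub>M distr M N2 Y"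
proof (rule pair_measure_eqI[symmetric])
  fix A B assume A: "A \<in> sets (distr M N1 X)" and B: "B \<in> sets (distr M N2 Y)"
  have "prob ((X -` A \<inter> space M) \<inter> (Y -` B \<inter> space M)) = prob (X -` A \<inter> space M) * prob (Y -` B \<inter> space M)"
    using A B by (intro indep_setD[OF ind] in_vimage_algebra) auto
  moreover have "(\<lambda>w. (X w, Y w)) -` (A \<times> B) \<inter> space M = (X -` A \<inter> space M) \<inter> (Y -` B \<inter> space M)"
    by auto
  ultimately show "emeasure (distr M N1 X) A * emeasure (distr M N2 Y) B =
      emeasure (distr M (N1 \<Otimes>\<^sub>M N2) (\<lambda>w. (X w, Y w))) (A \<times> B)"
    using A B by (simp add: emeasure_distr emeasure_eq_measure ennreal_mult)
qed (auto intro!: prob_space_imp_sigma_finite prob_space_distr cong: sets_pair_measure_cong)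

text \<open>The probability that the SINR of a user at distance \<open>sqrt t\<close> exceeds \<open>z\<close>, with \<open>k + 1\<close> beams.
  In the squared distance \<open>t\<close> the planar area element is the constant \<open>pi\<close>.\<close>

definition exceedance :: "real \<Rightarrow> real \<Rightarrow> nat \<Rightarrow> real \<Rightarrow> real \<Rightarrow> real" where
  "exceedance \<alpha> \<rho> k z t = exp (- (z / \<rho>) * (1 + t powr (\<alpha> / 2))) / (1 + z) ^ k"

lemma exceedance_antimono:
  assumes "z \<ge> 0" "\<rho> > 0" "\<alpha> > 0" "0 \<le> s" "s \<le> t"
  shows "exceedance \<alpha> \<rho> k z t \<le> exceedance \<alpha> \<rho> k z s"
proof -
  have "s powr (\<alpha> / 2) \<le> t powr (\<alpha> / 2)" using assms by (intro powr_mono2) auto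
  then have "(z / \<rho>) * (1 + s powr (\<alpha> / 2)) \<le> (z / \<rho>) * (1 + t powr (\<alpha> / 2))"
    using assms by (intro mult_left_mono) auto
  then show ?thesis unfolding exceedance_def using assms by (intro divide_right_mono) auto
qed

lemma continuous_on_exceedance:
  assumes "\<alpha> > 0" "z \<ge> 0"
  shows "continuous_on {0..} (exceedance \<alpha> \<rho> k z)"
  unfolding exceedance_def using assms
  by (intro continuous_intros continuous_on_powr') auto

lemma exceedance_integrable:
  assumes "\<alpha> > 0" "z \<ge> 0"
  shows "exceedance \<alpha> \<rho> k z integrable_on {0..t}"
  by (rule integrable_continuous_real, rule continuous_on_subset[OF continuous_on_exceedance]) (use assms in auto)

lemma exceedance_bounds:
  assumes "z \<ge> 0" "\<rho> > 0"
  shows "0 \<le> exceedance \<alpha> \<rho> k z t" "exceedance \<alpha> \<rho> k z t \<le> 1"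
proof -
  show "0 \<le> exceedance \<alpha> \<rho> k z t" using assms by (simp add: exceedance_def)
  have "0 \<le> (z / \<rho>) * (1 + t powr (\<alpha> / 2))" using assms by (intro mult_nonneg_nonneg) auto
  then have "exp (- (z / \<rho>) * (1 + t powr (\<alpha> / 2))) \<le> 1" by simp
  moreover have "1 \<le> (1 + z) ^ k" using assms by (intro one_le_power) auto
  ultimately have "exp (- (z / \<rho>) * (1 + t powr (\<alpha> / 2))) \<le> (1 + z) ^ k" by linarith
  moreover have "(1 + z) ^ k > 0" using assms by simp
  ultimately show "exceedance \<alpha> \<rho> k z t \<le> 1"
    unfolding exceedance_def by (simp only: divide_le_eq_1_pos)
qed

lemma measurable_sinr[measurable (raw)]:
  fixes b :: "'m::finite \<Rightarrow> 'a \<Rightarrow> complex ^ 'm"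
  assumes [measurable]: "g \<in> borel_measurable M" "u \<in> borel_measurable M" "\<And>k. b k \<in> borel_measurable M"
  shows "(\<lambda>x. sinr \<rho> (g x) (u x) (\<lambda>k. b k x) m) \<in> borel_measurable M"
  unfolding sinr_def by measurable

lemma sinr_nonneg: "\<rho> \<ge> 0 \<Longrightarrow> g \<ge> 0 \<Longrightarrow> sinr \<rho> g u b m \<ge> 0"
  by (simp add: sinr_def sum_nonneg)

lemma path_loss_b_pos: "d \<ge> 0 \<Longrightarrow> path_loss_b \<alpha> d > 0"
  by (simp add: path_loss_b_def add_pos_nonneg)

lemma measurable_path_loss_b[measurable]: "path_loss_b \<alpha> \<in> borel_measurable borel"
  unfolding path_loss_b_def by measurable

context beamforming_network
begin

lemma measurable_X: "X i \<in> borel_measurable P"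
  using locations by (simp add: poisson_point_process_def)

lemma measurable_h: "h i \<in> borel_measurable P"
  using fading_indep by (auto simp: indep_vars_def)

lemma distr_h: "distr P borel (h i) = cn_vec"
  by (rule distr_cn_vec[OF fading_entries_indep fading_entries_distr])

lemma prob_space_cn_vec: "prob_space (cn_vec :: (complex ^ 'm) measure)"
  unfolding distr_h[symmetric, of 0] by (rule prob_space_distr[OF measurable_h])

lemma measurable_families:
  "(\<lambda>w i. X i w) \<in> P \<rightarrow>\<^sub>M (\<Pi>\<^sub>M i\<in>UNIV. borel)"
  "(\<lambda>w i. h i w) \<in> P \<rightarrow>\<^sub>M (\<Pi>\<^sub>M i\<in>UNIV. borel)"
  "(\<lambda>w k. b k w) \<in> P \<rightarrow>\<^sub>M (\<Pi>\<^sub>M k\<in>UNIV. borel)"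
  by (rule measurable_PiM_single'; simp add: measurable_X measurable_h beams_measurable)+

lemma distr_h_family:
  "distr P (\<Pi>\<^sub>M i\<in>UNIV. borel) (\<lambda>w i. h i w) = (\<Pi>\<^sub>M i\<in>UNIV. cn_vec)"
  using indep_vars_iff_distr_eq_PiM'[where I = UNIV and M' = "\<lambda>_. borel" and X = h] fading_indep measurable_h
  by (simp add: restrict_UNIV distr_h)

text \<open>The nesting fixes the order of conditioning: beams outermost, then locations, then
  fading.\<close>

lemma distr_network:
  "distr P ((\<Pi>\<^sub>M k\<in>UNIV. borel) \<Otimes>\<^sub>M ((\<Pi>\<^sub>M i\<in>UNIV. borel) \<Otimes>\<^sub>M (\<Pi>\<^sub>M i\<in>UNIV. borel)))
      (\<lambda>w. (\<lambda>k. b k w, \<lambda>i. X i w, \<lambda>i. h i w)) =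
    distr P (\<Pi>\<^sub>M k\<in>UNIV. borel) (\<lambda>w k. b k w) \<Otimes>\<^sub>M
      (distr P (\<Pi>\<^sub>M i\<in>UNIV. borel) (\<lambda>w i. X i w) \<Otimes>\<^sub>M (\<Pi>\<^sub>M i\<in>UNIV. cn_vec))"
  using distr_pair_indep_set[OF measurable_families(1,2) locations_fading_indep]
    distr_pair_indep_set[OF measurable_families(3) _ beams_indep] measurable_families(1,2)
  by (simp add: distr_h_family)

lemma measure_cn_vec_sinr_path_loss_b:
  fixes \<beta> :: "'m \<Rightarrow> complex ^ 'm"
  assumes b: "orthonormal_beams \<beta>" and z: "z \<ge> 0" and rho: "\<rho> > 0" and r: "r \<ge> 0"
  shows "measure cn_vec {u. sinr \<rho> (path_loss_b \<alpha> r) u \<beta> m \<le> z} =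
    1 - exceedance \<alpha> \<rho> (CARD('m) - 1) z (r\<^sup>2)"
proof -
  \<comment> \<open>The base station itself is a separate case: the rules for powers assume a
    positive base, and \<open>0 powr _\<close> is 0.\<close>
  have "r\<^sup>2 powr (\<alpha> / 2) = r powr \<alpha>"
    using r by (cases "r = 0") (simp_all add: powr_powr flip: powr_numeral)
  then have "- z / (\<rho> * path_loss_b \<alpha> r) = - (z / \<rho>) * (1 + r\<^sup>2 powr (\<alpha> / 2))"
    by (simp only: path_loss_b_def divide_inverse inverse_mult_distrib inverse_inverse_eq minus_mult_left mult.assoc)
  then show ?thesis
    using measure_cn_vec_sinr_le[OF fading_entries_indep fading_entries_distr measurable_h b z rho path_loss_b_pos[OF r]]
    by (simp add: exceedance_def)
qed

text \<open>Given orthonormal beams and the locations, fading contributes a finite product over the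
  users in the cell; averaging over locations is the radial functional. The outcome is the same for
  all orthonormal beams, so averaging over them changes nothing.\<close>

lemma emeasure_all_sinr_le:
  fixes m :: 'm
  assumes lam: "lam \<ge> 0" and alpha: "\<alpha> > 0" and z: "z \<ge> 0" and rho: "\<rho> > 0" and D: "D \<ge> 0"
  shows "emeasure P {w \<in> space P. \<forall>i\<in>cell_users X D w.
            sinr \<rho> (path_loss_b \<alpha> (dist (X i w) 0)) (h i w) (\<lambda>k. b k w) m \<le> z} =
     ennreal (exp (- lam * pi * integral {0..D\<^sup>2} (exceedance \<alpha> \<rho> (CARD('m) - 1) z)))" (is "_ = ?V")
proof -
  define MB where "MB = (\<Pi>\<^sub>M k\<in>(UNIV::'m set). borel :: (complex ^ 'm) measure)"
  define MX where "MX = (\<Pi>\<^sub>M i\<in>(UNIV::nat set). borel :: (real ^ 2) measure)"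
  define MH where "MH = (\<Pi>\<^sub>M i\<in>(UNIV::nat set). borel :: (complex ^ 'm) measure)"
  define LB where "LB = distr P MB (\<lambda>w k. b k w)"
  define LX where "LX = distr P MX (\<lambda>w i. X i w)"
  define LH where "LH = (\<Pi>\<^sub>M i\<in>(UNIV::nat set). cn_vec :: (complex ^ 'm) measure)"
  \<comment> \<open>The event is moved to the space of values and phrased with a quantifier over all
    indices, a countable conjunction, so that it is measurable although the set of users is
    random.\<close>
  define A where "A = {p \<in> space (MB \<Otimes>\<^sub>M (MX \<Otimes>\<^sub>M MH)). \<forall>i. fst (snd p) i \<in> cball 0 D \<longrightarrow>
      sinr \<rho> (path_loss_b \<alpha> (dist (fst (snd p) i) 0)) (snd (snd p) i) (\<lambda>k. fst p k) m \<le> z}"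
  note mf = measurable_families[folded MX_def MB_def MH_def]
  have comp[measurable]: "(\<lambda>p. fst p k) \<in> borel_measurable (MB \<Otimes>\<^sub>M (MX \<Otimes>\<^sub>M MH))"
    "(\<lambda>p. fst (snd p) i) \<in> borel_measurable (MB \<Otimes>\<^sub>M (MX \<Otimes>\<^sub>M MH))"
    "(\<lambda>p. snd (snd p) i) \<in> borel_measurable (MB \<Otimes>\<^sub>M (MX \<Otimes>\<^sub>M MH))" for k i
    unfolding MB_def MX_def MH_def by measurable
  have A: "A \<in> sets (MB \<Otimes>\<^sub>M (MX \<Otimes>\<^sub>M MH))"
  proof -
    have [measurable]: "(\<lambda>p. sinr \<rho> (path_loss_b \<alpha> (dist (fst (snd p) i) 0)) (snd (snd p) i) (\<lambda>k. fst p k) m)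
        \<in> borel_measurable (MB \<Otimes>\<^sub>M (MX \<Otimes>\<^sub>M MH))" for i
      by (rule measurable_sinr) measurable
    show ?thesis unfolding A_def mem_cball by measurable
  qed
  have sL[measurable_cong]: "sets LB = sets MB" "sets LX = sets MX" "sets LH = sets MH"
    by (auto simp: LB_def LX_def LH_def MH_def intro!: sets_PiM_cong)
  have A': "A \<in> sets (LB \<Otimes>\<^sub>M (LX \<Otimes>\<^sub>M LH))"
    using A sL by (simp cong: sets_pair_measure_cong)
  interpret LH: product_prob_space "\<lambda>_::nat. cn_vec :: (complex ^ 'm) measure" UNIV
    using prob_space_cn_vec
    by (simp add: product_prob_space_def product_prob_space_axioms_def product_sigma_finite_def prob_space_imp_sigma_finite)
  interpret LHp: prob_space LH unfolding LH_def by (rule LH.prob_space_axioms)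
  interpret LXp: prob_space LX unfolding LX_def by (rule prob_space_distr[OF mf(1)])
  interpret XH: pair_prob_space LX LH ..
  have val: "emeasure (LX \<Otimes>\<^sub>M LH) (Pair \<beta> -` A) = ?V" if \<beta>: "orthonormal_beams \<beta>" for \<beta>
  proof -
    have s: "Pair \<beta> -` A \<in> sets (LX \<Otimes>\<^sub>M LH)" using A' by (rule sets_Pair1)
    have sm: "{u. sinr \<rho> g u \<beta> m \<le> z} \<in> sets borel" for g
      by measurable
    have "emeasure (LX \<Otimes>\<^sub>M LH) (Pair \<beta> -` A) = (\<integral>\<^sup>+x. emeasure LH (Pair x -` (Pair \<beta> -` A)) \<partial>LX)"
      by (rule LHp.emeasure_pair_measure_alt[OF s])
    also have "\<dots> = (\<integral>\<^sup>+w. emeasure LH (Pair (\<lambda>i. X i w) -` (Pair \<beta> -` A)) \<partial>P)"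
    proof -
      have "(\<lambda>x. emeasure LH (Pair x -` (Pair \<beta> -` A))) \<in> borel_measurable LX"
        by (rule LHp.measurable_emeasure_Pair[OF s])
      then show ?thesis unfolding LX_def by (subst nn_integral_distr[OF mf(1)]) auto
    qed
    also have "\<dots> = (\<integral>\<^sup>+w. ennreal (\<Prod>i\<in>cell_users X D w. 1 - exceedance \<alpha> \<rho> (CARD('m) - 1) z ((norm (X i w))\<^sup>2)) \<partial>P)"
    proof (rule nn_integral_cong)
      fix w assume w: "w \<in> space P"
      \<comment> \<open>With beams and locations fixed this is a cylinder: only the finitely many
        users in the cell constrain their fading vectors.\<close>
      have "Pair (\<lambda>i. X i w) -` (Pair \<beta> -` A) = {\<eta> \<in> space LH. \<forall>i\<in>cell_users X D w.
          \<eta> i \<in> {u. sinr \<rho> (path_loss_b \<alpha> (dist (X i w) 0)) u \<beta> m \<le> z}}"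
        by (auto simp: A_def LH_def MB_def MX_def MH_def space_pair_measure space_PiM cell_users_def)
      then have "emeasure LH (Pair (\<lambda>i. X i w) -` (Pair \<beta> -` A)) =
          (\<Prod>i\<in>cell_users X D w. emeasure cn_vec {u. sinr \<rho> (path_loss_b \<alpha> (dist (X i w) 0)) u \<beta> m \<le> z})"
        using sm unfolding LH_def
        by (simp only:, intro LH.emeasure_PiM_Collect finite_cell_users[OF locations w]) auto
      also have "\<dots> = (\<Prod>i\<in>cell_users X D w. ennreal (1 - exceedance \<alpha> \<rho> (CARD('m) - 1) z ((norm (X i w))\<^sup>2)))"
        by (simp add: LH.M.emeasure_eq_measure measure_cn_vec_sinr_path_loss_b[OF \<beta> z rho])
      also have "\<dots> = ennreal (\<Prod>i\<in>cell_users X D w. 1 - exceedance \<alpha> \<rho> (CARD('m) - 1) z ((norm (X i w))\<^sup>2))"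
        using exceedance_bounds[OF z rho] by (intro prod_ennreal) auto
      finally show "emeasure LH (Pair (\<lambda>i. X i w) -` (Pair \<beta> -` A)) =
        ennreal (\<Prod>i\<in>cell_users X D w. 1 - exceedance \<alpha> \<rho> (CARD('m) - 1) z ((norm (X i w))\<^sup>2))" .
    qed
    also have "\<dots> = ?V"
      using exceedance_bounds[OF z rho] exceedance_antimono[OF z rho alpha] exceedance_integrable[OF alpha z]
      by (intro poisson_radial_laplace_functional[OF locations lam D]) auto
    finally show ?thesis .
  qed
  have "{w \<in> space P. \<forall>i\<in>cell_users X D w.
            sinr \<rho> (path_loss_b \<alpha> (dist (X i w) 0)) (h i w) (\<lambda>k. b k w) m \<le> z} =
      (\<lambda>w. (\<lambda>k. b k w, \<lambda>i. X i w, \<lambda>i. h i w)) -` A \<inter> space P"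
    by (auto simp: A_def MB_def MX_def MH_def space_pair_measure space_PiM cell_users_def)
  then have "emeasure P {w \<in> space P. \<forall>i\<in>cell_users X D w.
            sinr \<rho> (path_loss_b \<alpha> (dist (X i w) 0)) (h i w) (\<lambda>k. b k w) m \<le> z} =
      emeasure (distr P (MB \<Otimes>\<^sub>M (MX \<Otimes>\<^sub>M MH)) (\<lambda>w. (\<lambda>k. b k w, \<lambda>i. X i w, \<lambda>i. h i w))) A"
    using A mf by (subst emeasure_distr) auto
  also have "\<dots> = emeasure (LB \<Otimes>\<^sub>M (LX \<Otimes>\<^sub>M LH)) A"
    using distr_network by (simp add: LB_def LX_def LH_def MB_def MX_def MH_def)
  also have "\<dots> = (\<integral>\<^sup>+\<beta>. emeasure (LX \<Otimes>\<^sub>M LH) (Pair \<beta> -` A) \<partial>LB)"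
    by (rule XH.emeasure_pair_measure_alt[OF A'])
  also have "\<dots> = (\<integral>\<^sup>+w. emeasure (LX \<Otimes>\<^sub>M LH) (Pair (\<lambda>k. b k w) -` A) \<partial>P)"
  proof -
    have "(\<lambda>\<beta>. emeasure (LX \<Otimes>\<^sub>M LH) (Pair \<beta> -` A)) \<in> borel_measurable LB"
      by (rule XH.measurable_emeasure_Pair[OF A'])
    then show ?thesis unfolding LB_def by (subst nn_integral_distr[OF mf(3)]) auto
  qed
  also have "\<dots> = (\<integral>\<^sup>+w. ?V \<partial>P)"
    using beams_orthonormal by (intro nn_integral_cong_AE) (auto elim!: eventually_mono simp: val)
  also have "\<dots> = ?V" by (simp add: emeasure_space_1)
  finally show ?thesis .
qed

lemma beam_outage_prob_nonneg_rate:
  fixes m :: 'm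
  assumes "lam \<ge> 0" "\<alpha> > 0" "\<rho> > 0" "D \<ge> 0" and x: "x \<ge> 0"
  shows "beam_outage_prob P (path_loss_b \<alpha>) \<rho> X h b D m x =
     exp (- lam * pi * integral {0..D\<^sup>2} (exceedance \<alpha> \<rho> (CARD('m) - 1) (exp x - 1)))"
proof -
  let ?s = "\<lambda>w i. sinr \<rho> (path_loss_b \<alpha> (dist (X i w) 0)) (h i w) (\<lambda>k. b k w) m"
  have s0: "?s w i \<ge> 0" for w i
    using assms by (intro sinr_nonneg less_imp_le[OF path_loss_b_pos]) auto
  have "beam_rate (path_loss_b \<alpha>) \<rho> X h b D m w \<le> x \<longleftrightarrow> (\<forall>i\<in>cell_users X D w. ?s w i \<le> exp x - 1)"
    if w: "w \<in> space P" for w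
  proof (cases "cell_users X D w = {}")
    case True
    \<comment> \<open>An empty cell has rate \<open>ln 1 = 0\<close>, and the condition on its users
      is vacuous; the equivalence holds because \<open>x\<close> is nonnegative.\<close>
    then show ?thesis using x by (simp add: beam_rate_def)
  next
    case False
    have fin: "finite (cell_users X D w)" by (rule finite_cell_users[OF locations w])
    let ?M = "MAX i\<in>cell_users X D w. ?s w i"
    have "0 \<le> ?M" using False fin s0 by (subst Max_ge_iff) auto
    then have "exp (ln (1 + ?M)) = 1 + ?M" by (intro exp_ln) linarith
    then have "ln (1 + ?M) \<le> x \<longleftrightarrow> 1 + ?M \<le> exp x"
      using exp_le_cancel_iff[of "ln (1 + ?M)" x] by (simp only:)
    also have "\<dots> \<longleftrightarrow> ?M \<le> exp x - 1" by linarith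
    also have "\<dots> \<longleftrightarrow> (\<forall>i\<in>cell_users X D w. ?s w i \<le> exp x - 1)"
      using False fin by (subst Max_le_iff) auto
    finally show ?thesis using False by (simp add: beam_rate_def)
  qed
  then have "{w \<in> space P. beam_rate (path_loss_b \<alpha>) \<rho> X h b D m w \<le> x} =
      {w \<in> space P. \<forall>i\<in>cell_users X D w. ?s w i \<le> exp x - 1}" by auto
  then show ?thesis
    using emeasure_all_sinr_le[of \<alpha> "exp x - 1" \<rho> D m] assms
    by (simp add: beam_outage_prob_def measure_def)
qed

lemma beam_outage_prob_neg_rate:
  assumes "\<rho> > 0" and x: "x < 0"
  shows "beam_outage_prob P (path_loss_b \<alpha>) \<rho> X h b D m x = 0"
proof -
  let ?s = "\<lambda>w i. sinr \<rho> (path_loss_b \<alpha> (dist (X i w) 0)) (h i w) (\<lambda>k. b k w) m"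
  have s0: "?s w i \<ge> 0" for w i
    using assms by (intro sinr_nonneg less_imp_le[OF path_loss_b_pos]) auto
  have "beam_rate (path_loss_b \<alpha>) \<rho> X h b D m w \<ge> 0" if w: "w \<in> space P" for w
  proof (cases "cell_users X D w = {}")
    case False
    then have "0 \<le> (MAX i\<in>cell_users X D w. ?s w i)"
      using finite_cell_users[OF locations w] s0 by (subst Max_ge_iff) auto
    then show ?thesis using False by (simp add: beam_rate_def)
  qed (simp add: beam_rate_def)
  then have "{w \<in> space P. beam_rate (path_loss_b \<alpha>) \<rho> X h b D m w \<le> x} = {}"
    using x by (auto simp: not_le intro: less_le_trans)
  then show ?thesis by (simp only: beam_outage_prob_def measure_empty)
qed

end

section \<open>The large system limit\<close>

text \<open>The substitution \<open>s = k * t powr q\<close> leads to the Gamma integral. The open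
  half-line is used because there the substitution is differentiable and the rules for powers
  apply.\<close>

lemma exp_powr_integral_greaterThan:
  fixes k q :: real
  assumes k: "k > 0" and q: "q > 0"
  defines "f \<equiv> \<lambda>t. exp (- k * t powr q)"
  shows "f absolutely_integrable_on {0<..}"
    and "integral {0<..} f = k powr (- 1 / q) / q * Gamma (1 / q)"
proof -
  let ?G = "\<lambda>s. s powr (1 / q - 1) / exp s"
  have "(?G has_integral Gamma (1 / q)) {0..}"
    using q by (intro Gamma_integral_real) auto
  then have hi: "(?G has_integral Gamma (1 / q)) {0<..}"
    by (subst has_integral_spike_set_eq[where T = "{0..}"]) (auto intro: negligible_subset[of "{0}"])
  then have G: "?G absolutely_integrable_on {0<..}" "integral {0<..} ?G = Gamma (1 / q)"
    by (auto intro!: nonnegative_absolutely_integrable_1)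
  define g where "g = (\<lambda>t. k * t powr q)"
  define g' where "g' = (\<lambda>t. k * (q * t powr (q - 1)))"
  have der: "(g has_field_derivative g' t) (at t within {0<..})" if "t \<in> {0<..}" for t
    unfolding g_def g'_def using that by (auto intro!: derivative_eq_intros)
  have inj: "inj_on g {0<..}"
  proof (rule inj_on_inverseI)
    fix t :: real assume "t \<in> {0<..}"
    then show "(g t / k) powr (1 / q) = t" using k q by (simp add: g_def powr_powr)
  qed
  have img: "g ` {0<..} = {0<..}"
  proof (intro equalityI subsetI)
    fix s :: real assume "s \<in> {0<..}"
    then have "s = g ((s / k) powr (1 / q))" "(s / k) powr (1 / q) > 0"
      using k q by (auto simp: g_def powr_powr)
    then show "s \<in> g ` {0<..}" by blast
  qed (use k in \<open>auto simp: g_def\<close>)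
  \<comment> \<open>The powers of \<open>t\<close> in the Jacobian and in the Gamma integrand
    cancel, leaving a constant multiple of \<open>f\<close>.\<close>
  have *: "\<bar>g' t\<bar> * ?G (g t) = (k powr (1 / q) * q) * f t" if "t \<in> {0<..}" for t
  proof -
    have t: "t > 0" using that by simp
    have Gg: "?G (g t) = k powr (1 / q - 1) * t powr (1 - q) * f t"
    proof -
      have "q * (1 / q - 1) = 1 - q" using q by (simp add: right_diff_distrib)
      then have "g t powr (1 / q - 1) = k powr (1 / q - 1) * t powr (1 - q)"
        using k t by (simp add: g_def powr_mult powr_powr)
      then show ?thesis by (simp add: f_def g_def exp_minus divide_inverse)
    qed
    have pt: "t powr (q - 1) * t powr (1 - q) = 1"
      using t by (simp flip: powr_add)
    have pk: "k * k powr (1 / q - 1) = k powr (1 / q)"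
      using k by (simp add: powr_mult_base)
    have g'_abs: "\<bar>g' t\<bar> = k * (q * t powr (q - 1))"
      using k q by (simp add: g'_def)
    have "\<bar>g' t\<bar> * ?G (g t) =
        (k * k powr (1 / q - 1)) * q * (t powr (q - 1) * t powr (1 - q)) * f t"
      unfolding Gg g'_abs by (simp only: mult_ac)
    also have "\<dots> = k powr (1 / q) * q * f t"
      unfolding pt pk by simp
    finally show ?thesis by simp
  qed
  have G': "(\<lambda>t. \<bar>g' t\<bar> * ?G (g t)) absolutely_integrable_on {0<..}"
      "integral {0<..} (\<lambda>t. \<bar>g' t\<bar> * ?G (g t)) = Gamma (1 / q)"
    using G has_absolute_integral_change_of_variables_1'[OF _ der inj, of ?G "Gamma (1 / q)"] by (auto simp: img)
  have S: "(\<lambda>t. (k powr (1 / q) * q) * f t) absolutely_integrable_on {0<..}"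
    using iffD1[OF set_integrable_cong[OF refl refl *] G'(1)] by simp
  have I: "integral {0<..} (\<lambda>t. (k powr (1 / q) * q) * f t) = Gamma (1 / q)"
    using G'(2) by (subst (asm) Henstock_Kurzweil_Integration.integral_cong[OF *]) auto
  have c: "k powr (1 / q) * q > 0" using k q by simp
  show "f absolutely_integrable_on {0<..}"
  proof -
    have "(\<lambda>t. inverse (k powr (1 / q) * q) * ((k powr (1 / q) * q) * f t)) = f"
      using k q by (simp add: fun_eq_iff field_simps)
    then show ?thesis
      using set_integrable_mult_right[where a = "inverse (k powr (1 / q) * q)", OF S] by simp
  qed
  show "integral {0<..} f = k powr (- 1 / q) / q * Gamma (1 / q)"
    using I c k q by (simp add: powr_minus field_simps)
qed

lemma exp_powr_integral_tendsto:
  fixes k q :: real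
  assumes k: "k > 0" and q: "q > 0"
  shows "((\<lambda>T. integral {0..T} (\<lambda>t. exp (- k * t powr q))) \<longlongrightarrow> k powr (- 1 / q) / q * Gamma (1 / q)) at_top"
proof -
  let ?f = "\<lambda>t. exp (- k * t powr q)"
  have neg: "negligible (({0<..} - {0..}) \<union> ({0..} - {0<..}) :: real set)"
    by (rule negligible_subset[of "{0}"]) auto
  have f: "?f absolutely_integrable_on {0..}"
    using exp_powr_integral_greaterThan(1)[OF k q] absolutely_integrable_spike_set_eq[of "{0<..}" "{0..}" ?f]
      neg by (auto intro: negligible_subset)
  have I: "integral {0..} ?f = k powr (- 1 / q) / q * Gamma (1 / q)"
    unfolding exp_powr_integral_greaterThan(2)[OF k q, symmetric]
    by (rule integral_spike_set) (auto intro: negligible_subset[OF neg])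
  have "((\<lambda>T. set_lebesgue_integral lebesgue {0..T} ?f) \<longlongrightarrow> set_lebesgue_integral lebesgue {0..} ?f) at_top"
    using f by (intro tendsto_set_lebesgue_integral_at_top) auto
  moreover have "set_lebesgue_integral lebesgue {0..} ?f = k powr (- 1 / q) / q * Gamma (1 / q)"
    using f I by (simp add: set_lebesgue_integral_eq_integral)
  moreover have "set_lebesgue_integral lebesgue {0..T} ?f = integral {0..T} ?f" for T
    by (rule set_lebesgue_integral_eq_integral, rule set_integrable_subset[OF f]) auto
  ultimately show ?thesis by simp
qed

text \<open>The case \<open>x = 0\<close> belongs to the first branch: since
  \<open>0 powr _ = 0\<close>, the formula would give 1 there, while the limit is 0 because a
  growing cell eventually contains users.\<close>

definition outage_limit :: "real \<Rightarrow> real \<Rightarrow> real \<Rightarrow> nat \<Rightarrow> real \<Rightarrow> real" where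
  "outage_limit \<beta> \<alpha> \<rho> k x = (if x \<le> 0 then 0 else
     exp (- \<beta> * ((exp x - 1) powr (- 2 / \<alpha>) * exp (- (exp x - 1) / \<rho>) / exp x ^ k)))"

lemma (in beamforming_network) beam_outage_prob_tendsto:
  fixes m :: 'm
  assumes lam: "lam > 0" and alpha: "\<alpha> > 2" and rho: "\<rho> > 0"
  shows "((\<lambda>D. beam_outage_prob P (path_loss_b \<alpha>) \<rho> X h b D m x) \<longlongrightarrow>
     outage_limit (2 * lam * pi / \<alpha> * Gamma (2 / \<alpha>) * \<rho> powr (2 / \<alpha>)) \<alpha> \<rho> (CARD('m) - 1) x) at_top"
proof (cases "x < 0")
  case True
  then show ?thesis using beam_outage_prob_neg_rate[OF rho True] by (simp add: outage_limit_def)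
next
  case False
  define k where "k = CARD('m) - 1"
  have ev: "\<forall>\<^sub>F D in at_top. beam_outage_prob P (path_loss_b \<alpha>) \<rho> X h b D m x =
     exp (- lam * pi * integral {0..D\<^sup>2} (exceedance \<alpha> \<rho> k (exp x - 1)))"
    using eventually_ge_at_top[of 0]
  proof eventually_elim
    case (elim D)
    then show ?case
      unfolding k_def using False assms by (intro beam_outage_prob_nonneg_rate) auto
  qed
  have sq: "filterlim (\<lambda>D::real. D\<^sup>2) at_top at_top" by real_asymp
  show ?thesis
  proof (cases "x = 0")
    case True
    \<comment> \<open>At rate 0 the exceedance is constantly 1, and the outage probability is that
      of an empty cell.\<close>
    have "((\<lambda>D. exp (- lam * pi * D\<^sup>2)) \<longlongrightarrow> 0) at_top" using lam by real_asymp
    moreover have "integral {0..D\<^sup>2} (exceedance \<alpha> \<rho> k (exp x - 1)) = D\<^sup>2" for D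
    proof -
      have "exceedance \<alpha> \<rho> k (exp x - 1) = (\<lambda>_. 1)"
        using True by (simp add: exceedance_def fun_eq_iff)
      then show ?thesis by simp
    qed
    ultimately show ?thesis
      using True by (subst tendsto_cong[OF ev]) (simp add: outage_limit_def)
  next
    case xn: False
    define z where "z = exp x - 1"
    have z: "z > 0" using False xn by (simp add: z_def)
    \<comment> \<open>The part of the exceedance that is free of the distance; \<open>L\<close> is
      the Gamma integral of the rest.\<close>
    define C where "C = exp (- (z / \<rho>)) / (1 + z) ^ k"
    define L where "L = (z / \<rho>) powr (- 1 / (\<alpha> / 2)) / (\<alpha> / 2) * Gamma (1 / (\<alpha> / 2))"
    have "integral {0..T} (exceedance \<alpha> \<rho> k z) = C * integral {0..T} (\<lambda>t. exp (- (z / \<rho>) * t powr (\<alpha> / 2)))" for T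
    proof -
      have "exceedance \<alpha> \<rho> k z = (\<lambda>t. C * exp (- (z / \<rho>) * t powr (\<alpha> / 2)))"
        by (simp add: exceedance_def C_def fun_eq_iff exp_add[symmetric] algebra_simps)
      then show ?thesis by simp
    qed
    moreover have "((\<lambda>D. integral {0..D\<^sup>2} (\<lambda>t. exp (- (z / \<rho>) * t powr (\<alpha> / 2)))) \<longlongrightarrow> L) at_top"
      unfolding L_def using z rho alpha
      by (intro filterlim_compose[OF exp_powr_integral_tendsto sq]) auto
    ultimately have "((\<lambda>D. exp (- lam * pi * integral {0..D\<^sup>2} (exceedance \<alpha> \<rho> k z))) \<longlongrightarrow>
        exp (- lam * pi * (C * L))) at_top"
      by (simp only:) (intro tendsto_intros)
    moreover have "lam * pi * (C * L) = (2 * lam * pi / \<alpha> * Gamma (2 / \<alpha>) * \<rho> powr (2 / \<alpha>)) *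
        (z powr (- 2 / \<alpha>) * exp (- z / \<rho>) / (1 + z) ^ k)"
      using z rho alpha by (simp add: C_def L_def powr_divide powr_minus field_simps)
    ultimately show ?thesis
      using False xn by (subst tendsto_cong[OF ev]) (simp add: outage_limit_def z_def k_def)
  qed
qed

section \<open>The capacity equation\<close>

text \<open>The left-hand side of the equation for \<open>y\<close>, with \<open>c\<close> in place of \<open>\<alpha> / 2 * ln (- \<beta> / ln \<epsilon>)\<close>.\<close>

definition capacity_eq :: "real \<Rightarrow> real \<Rightarrow> real \<Rightarrow> real \<Rightarrow> real" where
  "capacity_eq a B c y = a * ln y + ln (y - 1) + B * (y - 1) - c"

lemma capacity_eq_strict_mono:
  assumes "a \<ge> 0" "B > 0" "1 < x" "x < y"
  shows "capacity_eq a B c x < capacity_eq a B c y"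
proof -
  have "a * ln x \<le> a * ln y" using assms by (intro mult_left_mono) auto
  moreover have "ln (x - 1) < ln (y - 1)" using assms by simp
  moreover have "B * (x - 1) < B * (y - 1)" using assms by simp
  ultimately show ?thesis by (simp add: capacity_eq_def)
qed

lemma capacity_eq_le_iff:
  assumes "a \<ge> 0" "B > 0" "1 < x" "1 < y"
  shows "capacity_eq a B c x \<le> capacity_eq a B c y \<longleftrightarrow> x \<le> y"
  using capacity_eq_strict_mono[OF assms(1,2), of x y c] capacity_eq_strict_mono[OF assms(1,2), of y x c] assms
  by (cases x y rule: linorder_cases) auto

lemma capacity_eq_root_exists:
  assumes a: "a \<ge> 0" and B: "B > 0"
  shows "\<exists>y>1. capacity_eq a B c y = 0"
proof -
  \<comment> \<open>At \<open>y = 1 + exp (- t)\<close> the first and third summands are at most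
    \<open>a\<close> and \<open>B\<close>, so \<open>t\<close> makes \<open>ln (y - 1) = - t\<close>
    outweigh them. At \<open>y = 1 + exp s\<close> the term \<open>ln (y - 1) = s\<close> already
    reaches \<open>c\<close>.\<close>
  define t where "t = max 0 (a + B - c)"
  define s where "s = max 0 c"
  let ?l = "1 + exp (- t)" and ?u = "1 + exp s"
  have l: "exp (- t) \<le> 1" by (simp add: t_def)
  have u: "1 \<le> exp s" by (simp add: s_def)
  have "ln ?l \<le> exp (- t)" by (rule ln_add_one_self_le_self) simp
  then have "a * ln ?l \<le> a * 1" using l a by (intro mult_left_mono) linarith+
  moreover have "B * exp (- t) \<le> B * 1" using l B by (intro mult_left_mono) auto
  ultimately have "capacity_eq a B c ?l \<le> 0" by (simp add: capacity_eq_def t_def)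
  moreover have "0 \<le> capacity_eq a B c ?u"
  proof -
    have "0 \<le> a * ln ?u" using a by simp
    moreover have "0 \<le> B * exp s" using B by simp
    moreover have "c \<le> s" by (simp add: s_def)
    ultimately show ?thesis by (simp add: capacity_eq_def)
  qed
  moreover have gt1: "1 < y" if "y \<in> {?l..?u}" for y
  proof -
    have "1 < ?l" by simp
    also have "?l \<le> y" using that by simp
    finally show ?thesis .
  qed
  moreover have "continuous_on {?l..?u} (capacity_eq a B c)"
    unfolding capacity_eq_def
    using gt1 by (intro continuous_intros) force+
  moreover have "?l \<le> ?u" using l u by linarith
  ultimately obtain y where y: "?l \<le> y" "capacity_eq a B c y = 0"
    using IVT'[of "capacity_eq a B c" ?l 0 ?u] by blast
  moreover have "1 < y" by (rule less_le_trans[OF _ y(1)]) simp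
  ultimately show ?thesis by blast
qed

lemma ex1_capacity_eq_root:
  assumes a: "a \<ge> 0" and B: "B > 0"
  shows "\<exists>!y. 1 < y \<and> capacity_eq a B c y = 0"
  using capacity_eq_root_exists[OF assms, of c] capacity_eq_strict_mono[OF assms, of _ _ c]
  by (metis less_irrefl linorder_less_linear)

text \<open>Beyond 2 both logarithms are nonnegative, so the linear term alone is at most
  \<open>c\<close>. This is the source of the iterated logarithm.\<close>

lemma capacity_eq_root_bound:
  assumes a: "a \<ge> 0" and B: "B > 0" and y: "capacity_eq a B c y = 0"
  shows "y \<le> max 2 (1 + c / B)"
proof (cases "y \<le> 2")
  case False
  then have "0 \<le> a * ln y" "0 \<le> ln (y - 1)" using a by auto
  then have "B * (y - 1) \<le> c" using y by (simp add: capacity_eq_def)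
  then show ?thesis using B by (simp add: field_simps le_max_iff_disj)
qed simp

text \<open>Two logarithms turn the outage constraint into a linear inequality in
  \<open>ln y\<close>, \<open>ln (y - 1)\<close> and \<open>y - 1\<close>; multiplication by
  \<open>\<alpha> / 2\<close> normalises the coefficient of \<open>ln (y - 1)\<close> to 1.\<close>

lemma outage_limit_le_iff:
  assumes x: "x > 0" and beta: "\<beta> > 0" and alpha: "\<alpha> > 0" and rho: "\<rho> > 0" and eps: "0 < \<epsilon>" "\<epsilon> < 1"
  shows "outage_limit \<beta> \<alpha> \<rho> k x \<le> \<epsilon> \<longleftrightarrow>
    capacity_eq (\<alpha> / 2 * real k) (\<alpha> / (2 * \<rho>)) (\<alpha> / 2 * ln (- \<beta> / ln \<epsilon>)) (exp x) \<le> 0"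
proof -
  define y where "y = exp x"
  have y: "y > 1" using x by (simp add: y_def)
  define \<psi> where "\<psi> = (y - 1) powr (- 2 / \<alpha>) * exp (- (y - 1) / \<rho>) / y ^ k"
  define l where "l = - ln \<epsilon>"
  have l: "l > 0" using eps by (simp add: l_def)
  have psi: "\<psi> > 0" unfolding \<psi>_def using y by simp
  have lnpsi: "ln \<psi> = - (2 / \<alpha>) * ln (y - 1) - (y - 1) / \<rho> - real k * ln y"
    unfolding \<psi>_def using y rho by (simp add: ln_mult ln_div ln_powr ln_realpow) (simp add: field_simps)
  have "outage_limit \<beta> \<alpha> \<rho> k x \<le> \<epsilon> \<longleftrightarrow> exp (- \<beta> * \<psi>) \<le> exp (- l)"
    using x eps by (simp add: outage_limit_def \<psi>_def y_def l_def)
  also have "\<dots> \<longleftrightarrow> l / \<beta> \<le> \<psi>" using beta by (simp add: field_simps)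
  also have "\<dots> \<longleftrightarrow> ln (l / \<beta>) \<le> ln \<psi>" using beta l psi by simp
  also have "ln (l / \<beta>) = - ln (\<beta> / l)" using beta l by (simp add: ln_div)
  also have "- ln (\<beta> / l) \<le> ln \<psi> \<longleftrightarrow> - (\<alpha> / 2) * ln \<psi> - \<alpha> / 2 * ln (\<beta> / l) \<le> 0"
  proof -
    have "- (\<alpha> / 2) * ln \<psi> - \<alpha> / 2 * ln (\<beta> / l) = (\<alpha> / 2) * (- ln (\<beta> / l) - ln \<psi>)"
      by (simp add: algebra_simps)
    then show ?thesis using alpha by (simp only: mult_le_0_iff) auto
  qed
  also have "- (\<alpha> / 2) * ln \<psi> - \<alpha> / 2 * ln (\<beta> / l) =
      capacity_eq (\<alpha> / 2 * real k) (\<alpha> / (2 * \<rho>)) (\<alpha> / 2 * ln (- \<beta> / ln \<epsilon>)) y"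
    unfolding capacity_eq_def lnpsi l_def using alpha rho by (simp add: field_simps)
  finally show ?thesis by (simp add: y_def)
qed

text \<open>By monotonicity of the equation the admissible rates form the half-line ending at
  \<open>ln y\<close>; nonpositive rates belong to it because their limiting outage is 0.\<close>

lemma outage_capacity_limit:
  assumes beta: "\<beta> > 0" and alpha: "\<alpha> > 0" and rho: "\<rho> > 0" and eps: "0 < \<epsilon>" "\<epsilon> < 1"
    and y: "y > 1" "capacity_eq (\<alpha> / 2 * real k) (\<alpha> / (2 * \<rho>)) (\<alpha> / 2 * ln (- \<beta> / ln \<epsilon>)) y = 0"
  shows "outage_capacity (outage_limit \<beta> \<alpha> \<rho> k) \<epsilon> = ln y"
proof -
  have "outage_limit \<beta> \<alpha> \<rho> k x \<le> \<epsilon> \<longleftrightarrow> x \<le> ln y" for x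
  proof (cases "x > 0")
    case True
    have "outage_limit \<beta> \<alpha> \<rho> k x \<le> \<epsilon> \<longleftrightarrow> exp x \<le> y"
      unfolding outage_limit_le_iff[OF True beta alpha rho eps] y(2)[symmetric]
      using True y(1) alpha rho by (intro capacity_eq_le_iff) auto
    also have "\<dots> \<longleftrightarrow> x \<le> ln y" using y(1) by (simp add: ln_ge_iff)
    finally show ?thesis .
  next
    case False
    moreover have "ln y > 0" using y(1) by simp
    ultimately show ?thesis using eps by (simp add: outage_limit_def)
  qed
  then have "{x. outage_limit \<beta> \<alpha> \<rho> k x \<le> \<epsilon>} = {..ln y}" by auto
  then show ?thesis by (simp add: outage_capacity_def)
qed

lemma (in beamforming_network) outage_capacity_b_eq:
  fixes m :: 'm
  assumes lam: "lam > 0" and alpha: "\<alpha> > 2" and rho: "\<rho> > 0" and eps: "0 < \<epsilon>" "\<epsilon> < 1"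
    and y: "y > 1" "capacity_eq (\<alpha> / 2 * (real CARD('m) - 1)) (\<alpha> / (2 * \<rho>))
       (\<alpha> / 2 * ln (- (2 * lam * pi / \<alpha> * Gamma (2 / \<alpha>) * \<rho> powr (2 / \<alpha>)) / ln \<epsilon>)) y = 0"
  shows "outage_capacity_b P \<alpha> \<rho> X h b m \<epsilon> = ln y"
proof -
  let ?\<beta> = "2 * lam * pi / \<alpha> * Gamma (2 / \<alpha>) * \<rho> powr (2 / \<alpha>)"
  have "Gamma (2 / \<alpha>) > 0" using alpha by (intro Gamma_real_pos) auto
  then have beta: "?\<beta> > 0" using lam alpha rho by simp
  have "Lim at_top (\<lambda>D. beam_outage_prob P (path_loss_b \<alpha>) \<rho> X h b D m x) =
      outage_limit ?\<beta> \<alpha> \<rho> (CARD('m) - 1) x" for x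
    by (rule tendsto_Lim[OF _ beam_outage_prob_tendsto[OF lam alpha rho]]) simp
  then show ?thesis
    unfolding outage_capacity_b_def using beta alpha rho eps y
    by (simp only:) (intro outage_capacity_limit; simp add: of_nat_diff)
qed

lemma ln_capacity_bigo:
  fixes \<rho> K :: real
  assumes "\<rho> > 0" "K > 0"
  shows "(\<lambda>lam. ln (2 + \<rho> * ln (K * lam))) \<in> O(\<lambda>lam. ln (ln lam))"
  using assms by real_asymp

text \<open>Each intensity has its own network, hence the dependence of \<open>P\<close>,
  \<open>X\<close>, \<open>h\<close> and \<open>b\<close> on \<open>lam\<close>. Convergence and
  unique solvability are asserted explicitly because \<open>Lim\<close> and \<open>THE\<close> carry
  meaning only then.\<close>

theorem theorem3:
  fixes P :: "real \<Rightarrow> 'w measure"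
    and X :: "real \<Rightarrow> nat \<Rightarrow> 'w \<Rightarrow> real ^ 2"
    and h :: "real \<Rightarrow> nat \<Rightarrow> 'w \<Rightarrow> complex ^ 'm"
    and b :: "real \<Rightarrow> 'm \<Rightarrow> 'w \<Rightarrow> complex ^ 'm"
    and m :: 'm
    and \<alpha> \<rho> \<epsilon> :: real
  assumes "\<alpha> > 2" and "\<rho> > 0" and "0 < \<epsilon>" and "\<epsilon> < 1"
  shows
    "(\<forall>lam>0. beamforming_network (P lam) lam (X lam) (h lam) (b lam) \<longrightarrow>
        (let a = \<alpha> / 2 * (real CARD('m) - 1);
             \<beta> = 2 * lam * pi / \<alpha> * Gamma (2 / \<alpha>) * \<rho> powr (2 / \<alpha>);
             sol = (\<lambda>y. y \<in> {1<..} \<and>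
                        ln (y powr a * (y - 1)) + \<alpha> / (2 * \<rho>) * (y - 1)
                          - \<alpha> / 2 * ln (- \<beta> / ln \<epsilon>) = 0)
         in (\<forall>x. \<exists>L. ((\<lambda>D. beam_outage_prob (P lam) (path_loss_b \<alpha>) \<rho> (X lam) (h lam) (b lam) D m x)
                        \<longlongrightarrow> L) at_top) \<and>
            (\<exists>!y. sol y) \<and>
            outage_capacity_b (P lam) \<alpha> \<rho> (X lam) (h lam) (b lam) m \<epsilon> = ln (THE y. sol y))) \<and>
     ((\<forall>lam>0. beamforming_network (P lam) lam (X lam) (h lam) (b lam)) \<longrightarrow>
        (\<lambda>lam. outage_capacity_b (P lam) \<alpha> \<rho> (X lam) (h lam) (b lam) m \<epsilon>)
          \<in> O(\<lambda>lam. ln (ln lam)))"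
proof -
  define a where "a = \<alpha> / 2 * (real CARD('m) - 1)"
  define B where "B = \<alpha> / (2 * \<rho>)"
  define \<beta> where "\<beta> = (\<lambda>lam. 2 * lam * pi / \<alpha> * Gamma (2 / \<alpha>) * \<rho> powr (2 / \<alpha>))"
  define c where "c = (\<lambda>lam. \<alpha> / 2 * ln (- \<beta> lam / ln \<epsilon>))"
  have "1 \<le> real CARD('m)" by (simp add: Suc_leI)
  then have a: "a \<ge> 0" using assms by (simp add: a_def)
  have B: "B > 0" using assms by (simp add: B_def)
  have sol: "(\<lambda>y. y \<in> {1<..} \<and> ln (y powr a * (y - 1)) + \<alpha> / (2 * \<rho>) * (y - 1) - \<alpha> / 2 * ln (- \<beta> lam / ln \<epsilon>) = 0)
      = (\<lambda>y. 1 < y \<and> capacity_eq a B (c lam) y = 0)" for lam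
  proof (intro ext conj_cong)
    fix y :: real assume "1 < y"
    then have "ln (y powr a * (y - 1)) = a * ln y + ln (y - 1)" by (simp add: ln_mult ln_powr)
    then show "(ln (y powr a * (y - 1)) + \<alpha> / (2 * \<rho>) * (y - 1) - \<alpha> / 2 * ln (- \<beta> lam / ln \<epsilon>) = 0) =
       (capacity_eq a B (c lam) y = 0)"
      by (simp add: capacity_eq_def B_def c_def)
  qed simp
  define root where "root = (\<lambda>lam. THE y. 1 < y \<and> capacity_eq a B (c lam) y = 0)"
  have root: "root lam > 1" "capacity_eq a B (c lam) (root lam) = 0" for lam
    using theI'[OF ex1_capacity_eq_root[OF a B, of "c lam"]] by (auto simp: root_def)
  have cap: "outage_capacity_b (P lam) \<alpha> \<rho> (X lam) (h lam) (b lam) m \<epsilon> = ln (root lam)"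
    if "lam > 0" "beamforming_network (P lam) lam (X lam) (h lam) (b lam)" for lam
    using root[of lam] that assms unfolding a_def B_def c_def \<beta>_def
    by (intro beamforming_network.outage_capacity_b_eq) auto
  have part1: "let a = \<alpha> / 2 * (real CARD('m) - 1);
             \<beta> = 2 * lam * pi / \<alpha> * Gamma (2 / \<alpha>) * \<rho> powr (2 / \<alpha>);
             sol = (\<lambda>y. y \<in> {1<..} \<and>
                        ln (y powr a * (y - 1)) + \<alpha> / (2 * \<rho>) * (y - 1)
                          - \<alpha> / 2 * ln (- \<beta> / ln \<epsilon>) = 0)
         in (\<forall>x. \<exists>L. ((\<lambda>D. beam_outage_prob (P lam) (path_loss_b \<alpha>) \<rho> (X lam) (h lam) (b lam) D m x)
                        \<longlongrightarrow> L) at_top) \<and>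
            (\<exists>!y. sol y) \<and>
            outage_capacity_b (P lam) \<alpha> \<rho> (X lam) (h lam) (b lam) m \<epsilon> = ln (THE y. sol y)"
    if lam: "lam > 0" and net: "beamforming_network (P lam) lam (X lam) (h lam) (b lam)" for lam
    unfolding Let_def a_def[symmetric] \<beta>_def[symmetric, THEN fun_cong, of lam, simplified] sol[unfolded \<beta>_def]
    using cap[OF lam net] ex1_capacity_eq_root[OF a B]
      beamforming_network.beam_outage_prob_tendsto[OF net lam assms(1,2)]
    unfolding root_def by blast
  have part2: "(\<lambda>lam. outage_capacity_b (P lam) \<alpha> \<rho> (X lam) (h lam) (b lam) m \<epsilon>) \<in> O(\<lambda>lam. ln (ln lam))"
    if net: "\<forall>lam>0. beamforming_network (P lam) lam (X lam) (h lam) (b lam)"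
  proof -
    \<comment> \<open>The constant for which \<open>- \<beta> lam / ln \<epsilon> = K * lam\<close>;
      the root bound then reads \<open>1 + \<rho> * ln (K * lam)\<close>, or 2 if that is
      larger.\<close>
    define K where "K = 2 * pi / \<alpha> * Gamma (2 / \<alpha>) * \<rho> powr (2 / \<alpha>) / (- ln \<epsilon>)"
    have "Gamma (2 / \<alpha>) > 0" using assms by (intro Gamma_real_pos) auto
    then have K: "K > 0" unfolding K_def using assms by (intro divide_pos_pos mult_pos_pos) auto
    have cK: "c lam / B = \<rho> * ln (K * lam)" for lam
    proof -
      have "- \<beta> lam / ln \<epsilon> = K * lam" by (simp add: \<beta>_def K_def)
      then show ?thesis using assms by (simp add: c_def B_def)
    qed
    have "filterlim (\<lambda>lam. ln (K * lam)) at_top at_top" using K by real_asymp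
    then have ev: "\<forall>\<^sub>F lam in at_top. ln (K * lam) \<ge> 0" by (simp add: filterlim_at_top)
    have "\<forall>\<^sub>F lam in at_top. norm (outage_capacity_b (P lam) \<alpha> \<rho> (X lam) (h lam) (b lam) m \<epsilon>) \<le>
        norm (ln (2 + \<rho> * ln (K * lam)))"
      using ev eventually_gt_at_top[of 0]
    proof eventually_elim
      case (elim lam)
      have "0 \<le> \<rho> * ln (K * lam)" using elim(1) assms by simp
      \<comment> \<open>For a nonnegative logarithm the sum dominates both entries of the maximum,
        so one expression serves for all large \<open>lam\<close>.\<close>
      then have "root lam \<le> 2 + \<rho> * ln (K * lam)"
        using capacity_eq_root_bound[OF a B root(2)[of lam]] by (simp add: cK)
      then have "ln (root lam) \<le> ln (2 + \<rho> * ln (K * lam))" using root(1)[of lam] by simp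
      moreover have "ln (root lam) \<ge> 0" using root(1)[of lam] by simp
      ultimately show ?case using cap[OF elim(2)] net elim(2) by simp
    qed
    then have "(\<lambda>lam. outage_capacity_b (P lam) \<alpha> \<rho> (X lam) (h lam) (b lam) m \<epsilon>)
        \<in> O(\<lambda>lam. ln (2 + \<rho> * ln (K * lam)))"
      by (rule landau_o.big_mono)
    then show ?thesis
      using ln_capacity_bigo[OF assms(2) K] by (rule landau_o.big_trans)
  qed
  show ?thesis using part1 part2 by blast
qed

end
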